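(* Let $d\ge1$. Let $K:(\mathbb{R}_*^d)^2\to\mathbb{R}$ be continuous with $K(x,y)=K(y,x)\ge0$, homogeneous in the sense that $K(rx,ry)=r^\gamma K(x,y)$ for $r>0$, $x,y\in\mathbb{R}_*^d$, and suppose that $$c_1(|x|+|y|)^\gamma\Phi_p\Big(\frac{|x|}{|x|+|y|}\Big)\le K(x,y)\le c_2(|x|+|y|)^\gamma\Phi_p\Big(\frac{|x|}{|x|+|y|}\Big),\qquad x,y\in\mathbb{R}_*^d,$$ where $\Phi_p(s)=s^{-p}(1-s)^{-p}$ for $0<s<1$, $0<c_1\le c_2<\infty$, and $\gamma,p\in\mathbb{R}$ satisfy $\gamma+2p\ge0$, $\gamma+p<1$, $\gamma<1$. Suppose that $F\in\mathcal{M}_+(\mathbb{R}_*^d)$ is a self-similar profile (with finite mass) for the coagulation equation with kernel $K$. Then there exists $\theta_0\in\Delta^{d-1}$ such that $F$ has the form $$F(\xi)=\frac{\sqrt d}{|\xi|^{d-1}}F_0(|\xi|)\,\delta\Big(\frac{\xi}{|\xi|}-\theta_0\Big),$$ where $F_0\in\mathcal{M}_+((0,\infty))$ is a self-similar profile for the one-component coagulation equation (i.e. $d=1$) with coagulation kernel $K_{\theta_0}(s,r)=K(s\theta_0,r\theta_0)$, $s,r\in(0,\infty)$.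
   Context: Notation: $\mathbb{R}_*^d=[0,\infty)^d\setminus\{O\}$ with $O=(0,\dots,0)$ (so $\mathbb{R}_*^1=(0,\infty)$); $|x|=\sum_{j=1}^d|x_j|$; $\Delta^{d-1}=\{\theta\in\mathbb{R}_*^d:|\theta|=1\}$; $\mathcal{M}_+(X)$ is the set of nonnegative Radon measures on $X$. Definition (self-similar profile). Let $d\ge1$ and let $K$ be a continuous, symmetric, nonnegative kernel on $(\mathbb{R}_*^d)^2$, homogeneous of degree $\gamma$, satisfying the two-sided bounds $$c_1(|x|+|y|)^\gamma\Phi_p\Big(\frac{|x|}{|x|+|y|}\Big)\le K(x,y)\le c_2(|x|+|y|)^\gamma\Phi_p\Big(\frac{|x|}{|x|+|y|}\Big),\qquad x,y\in\mathbb{R}_*^d,$$ where $\Phi_p(s)=s^{-p}(1-s)^{-p}$ for $0<s<1$ and $0<c_1\le c_2<\infty$, with $\gamma,p\in\mathbb{R}$ such that $\gamma+2p\ge0$, $\gamma+p<1$, $\gamma<1$. A measure $F\in\mathcal{M}_+(\mathbb{R}_*^d)$ with $$\int_{\{|\xi|\ge1\}}|\xi|^{\gamma+p}F(d\xi)+\int_{\{|\xi|<1\}}|\xi|^{1-p}F(d\xi)+\int_{\mathbb{R}_*^d}|\xi|F(d\xi)<\infty$$ is a self-similar profile for the coagulation equation with kernel $K$ if for all $\psi\in C_c^1(\mathbb{R}_*^d)$ $$0=\frac12\int_{\mathbb{R}_*^d}\int_{\mathbb{R}_*^d}F(d\xi)F(d\eta)K(\xi,\eta)[\psi(\xi+\eta)-\psi(\xi)-\psi(\eta)]+\frac{1}{1-\gamma}\int_{\mathbb{R}_*^d}F(d\xi)[\psi(\xi)-\xi\cdot\partial_\xi\psi(\xi)].$$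 Meaning of the formula for $F$: in the coordinates $\rho=|\xi|$, $\theta=\xi/|\xi|$ one has $d\xi=\frac{\rho^{d-1}}{\sqrt d}\,d\rho\,d\nu(\theta)$, where $\nu$ is the $(d-1)$-dimensional Hausdorff measure on $\Delta^{d-1}$, and $\delta(\cdot-\theta_0)$ is the Dirac measure on $\Delta^{d-1}$ at $\theta_0$. Thus the formula means $\int_{\mathbb{R}_*^d}\psi(\xi)F(d\xi)=\int_{(0,\infty)}\psi(\rho\theta_0)F_0(d\rho)$ for all $\psi\in C_c(\mathbb{R}_*^d)$. *)

theory Defs
  imports "HOL-Analysis.Analysis"
begin

(* Everything is set up over an arbitrary Euclidean space, so that the type real ^ 'n (d = CARD('n))
   and the one-component case, the type real, are instances of the same definitions. *)

definition punctured_orthant :: "'a::euclidean_space set" where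
  "punctured_orthant = {x. \<forall>b\<in>Basis. 0 \<le> x \<bullet> b} - {0}"

definition l1_norm :: "'a::euclidean_space \<Rightarrow> real" where
  "l1_norm x = (\<Sum>b\<in>Basis. \<bar>x \<bullet> b\<bar>)"

definition unit_simplex :: "'a::euclidean_space set" where
  "unit_simplex = {\<theta> \<in> punctured_orthant. l1_norm \<theta> = 1}"

lemma punctured_orthant_vec:
  "punctured_orthant = {x :: real ^ 'n. \<forall>i. 0 \<le> x $ i} - {0}"
  by (auto simp: punctured_orthant_def Basis_vec_def inner_axis)

lemma punctured_orthant_real: "punctured_orthant = {0::real<..}"
  by (auto simp: punctured_orthant_def)

lemma l1_norm_vec: "l1_norm (x :: real ^ 'n) = (\<Sum>i\<in>UNIV. \<bar>x $ i\<bar>)"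
proof -
  have B: "(Basis :: (real ^ 'n) set) = range (\<lambda>i. axis i 1)"
    by (auto simp: Basis_vec_def)
  have "inj (\<lambda>i. axis i 1 :: real ^ 'n)"
    by (auto simp: inj_on_def axis_eq_axis)
  then have "(\<Sum>b\<in>range (\<lambda>i. axis i 1 :: real ^ 'n). \<bar>x \<bullet> b\<bar>) = (\<Sum>i\<in>UNIV. \<bar>x \<bullet> axis i 1\<bar>)"
    by (simp add: sum.reindex)
  then show ?thesis
    by (simp only: l1_norm_def B) (simp add: inner_axis)
qed

lemma l1_norm_real: "l1_norm (x :: real) = \<bar>x\<bar>"
  by (simp add: l1_norm_def)

(* Nonnegative Radon measures on X, as measures with space X carrying the Borel sets of the
   subspace X. Compactness is compactness in X, so for X = punctured_orthant such a measure may have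
   infinite mass near the origin and near infinity. *)
definition radon_measure_on :: "'a::euclidean_space set \<Rightarrow> 'a measure \<Rightarrow> bool" where
  "radon_measure_on X M \<longleftrightarrow>
     sets M = sets (restrict_space borel X) \<and>
     (\<forall>C. compact C \<and> C \<subseteq> X \<longrightarrow> emeasure M C < \<infinity>) \<and>
     (\<forall>A\<in>sets M. emeasure M A = (SUP C\<in>{C. compact C \<and> C \<subseteq> A}. emeasure M C))"

definition compactly_supported_on :: "'a::euclidean_space set \<Rightarrow> ('a \<Rightarrow> real) \<Rightarrow> bool" where
  "compactly_supported_on X \<psi> \<longleftrightarrow> (\<exists>C. compact C \<and> C \<subseteq> X \<and> (\<forall>x\<in>X - C. \<psi> x = 0))"

definition Cc_on :: "'a::euclidean_space set \<Rightarrow> ('a \<Rightarrow> real) \<Rightarrow> bool" where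
  "Cc_on X \<psi> \<longleftrightarrow> continuous_on X \<psi> \<and> compactly_supported_on X \<psi>"

(* psi is C^1 on X with compact support in X, and D is its gradient. The punctured orthant contains
   its boundary faces, hence the derivative within X; it is unique there because the orthant is
   convex with nonempty interior. *)
definition Cc1_on :: "'a::euclidean_space set \<Rightarrow> ('a \<Rightarrow> real) \<Rightarrow> ('a \<Rightarrow> 'a) \<Rightarrow> bool" where
  "Cc1_on X \<psi> D \<longleftrightarrow>
     (\<forall>x\<in>X. (\<psi> has_derivative (\<lambda>h. D x \<bullet> h)) (at x within X)) \<and>
     continuous_on X D \<and> compactly_supported_on X \<psi>"

definition Phi :: "real \<Rightarrow> real \<Rightarrow> real" where
  "Phi p s = s powr (- p) * (1 - s) powr (- p)"

definition coagulation_kernel ::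
  "real \<Rightarrow> real \<Rightarrow> real \<Rightarrow> real \<Rightarrow> ('a::euclidean_space \<Rightarrow> 'a \<Rightarrow> real) \<Rightarrow> bool" where
  "coagulation_kernel \<gamma> p c\<^sub>1 c\<^sub>2 K \<longleftrightarrow>
     \<gamma> + 2 * p \<ge> 0 \<and> \<gamma> + p < 1 \<and> \<gamma> < 1 \<and> 0 < c\<^sub>1 \<and> c\<^sub>1 \<le> c\<^sub>2 \<and>
     continuous_on (punctured_orthant \<times> punctured_orthant) (\<lambda>(x, y). K x y) \<and>
     (\<forall>x\<in>punctured_orthant. \<forall>y\<in>punctured_orthant.
        K x y = K y x \<and> 0 \<le> K x y \<and>
        (\<forall>r>0. K (r *\<^sub>R x) (r *\<^sub>R y) = r powr \<gamma> * K x y) \<and>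
        c\<^sub>1 * (l1_norm x + l1_norm y) powr \<gamma> * Phi p (l1_norm x / (l1_norm x + l1_norm y)) \<le> K x y \<and>
        K x y \<le> c\<^sub>2 * (l1_norm x + l1_norm y) powr \<gamma> * Phi p (l1_norm x / (l1_norm x + l1_norm y)))"

(* The integrals of the weak equation are Lebesgue integrals over space F = punctured_orthant; they
   converge absolutely thanks to the kernel bounds and the moment condition. *)
definition self_similar_profile ::
  "real \<Rightarrow> real \<Rightarrow> ('a::euclidean_space \<Rightarrow> 'a \<Rightarrow> real) \<Rightarrow> 'a measure \<Rightarrow> bool" where
  "self_similar_profile \<gamma> p K F \<longleftrightarrow>
     (\<exists>c\<^sub>1 c\<^sub>2. coagulation_kernel \<gamma> p c\<^sub>1 c\<^sub>2 K) \<and>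
     radon_measure_on punctured_orthant F \<and>
     (\<integral>\<^sup>+\<xi>\<in>{\<xi>. l1_norm \<xi> \<ge> 1}. ennreal (l1_norm \<xi> powr (\<gamma> + p)) \<partial>F)
       + (\<integral>\<^sup>+\<xi>\<in>{\<xi>. l1_norm \<xi> < 1}. ennreal (l1_norm \<xi> powr (1 - p)) \<partial>F)
       + (\<integral>\<^sup>+\<xi>. ennreal (l1_norm \<xi>) \<partial>F) < \<infinity> \<and>
     (\<forall>\<psi> D. Cc1_on punctured_orthant \<psi> D \<longrightarrow>
        0 = 1 / 2 * (\<integral>\<xi>. (\<integral>\<eta>. K \<xi> \<eta> * (\<psi> (\<xi> + \<eta>) - \<psi> \<xi> - \<psi> \<eta>) \<partial>F) \<partial>F)
            + 1 / (1 - \<gamma>) * (\<integral>\<xi>. \<psi> \<xi> - \<xi> \<bullet> D \<xi> \<partial>F))"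

end

theory Submission
  imports Defs
begin

text \<open>
  Functions homogeneous of degree one make the drift term of the weak equation vanish. Testing with
  the difference of the \<open>l1\<close> norm and the Euclidean norm therefore leaves, formally, only the integral
  of \<open>K(x, y) (\<bar>x\<bar>\<^sub>2 + \<bar>y\<bar>\<^sub>2 - \<bar>x + y\<bar>\<^sub>2)\<close> against \<open>F \<otimes> F\<close>, which must be zero. As the kernel is positive,
  almost all pairs \<open>(x, y)\<close> are parallel, so that \<open>F\<close> lives on one ray, and the image of \<open>F\<close> under the
  \<open>l1\<close> norm solves the one-component equation.

  This function is truncated by \<open>X = cutoff n\<close>, evaluated at \<open>s = \<bar>x\<bar>\<^sub>1\<close>. Since \<open>s X'(s)\<close> is bounded and tends to zero, finite mass suffices for the drift term to disappear in the
  limit. The truncation near the origin contributes with the favourable sign, so no information on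
  \<open>F\<close> near the origin beyond the moment condition is needed; only the part where \<open>X\<close> decreases
  has to be estimated, and there \<open>\<bar>x\<bar>\<^sub>1 + \<bar>y\<bar>\<^sub>1 \<ge> 1\<close>, so that the moments of \<open>F\<close> control the kernel.
\<close>

subsection \<open>The punctured orthant\<close>

lemma l1_norm_eq_inner:
  assumes "x \<in> punctured_orthant"
  shows "l1_norm x = One \<bullet> x"
  using assms unfolding l1_norm_def punctured_orthant_def inner_sum_left
  by (intro sum.cong) (auto simp: inner_commute)

lemma norm_le_l1_norm: "norm x \<le> l1_norm x"
  unfolding l1_norm_def by (rule norm_le_l1)

lemma l1_norm_pos:
  assumes "x \<in> punctured_orthant"
  shows "0 < l1_norm x"
proof -
  have "0 < norm x"
    using assms by (simp add: punctured_orthant_def)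
  then show ?thesis
    using norm_le_l1_norm[of x] by linarith
qed

text \<open>Coordinate sums are positive on the punctured orthant and add up, so two points cannot
  cancel to the missing origin.\<close>

lemma punctured_orthant_add:
  assumes "x \<in> punctured_orthant" "y \<in> punctured_orthant"
  shows "x + y \<in> punctured_orthant"
proof -
  have "One \<bullet> x > 0" "One \<bullet> y > 0"
    using assms l1_norm_pos l1_norm_eq_inner by metis+
  then have "One \<bullet> (x + y) > 0"
    by (simp add: inner_add_right)
  then have "x + y \<noteq> 0"
    by (metis inner_zero_right less_irrefl)
  then show ?thesis
    using assms by (auto simp: punctured_orthant_def inner_add_left)
qed

lemma l1_norm_add:
  assumes "x \<in> punctured_orthant" "y \<in> punctured_orthant"
  shows "l1_norm (x + y) = l1_norm x + l1_norm y"
  using assms by (simp add: l1_norm_eq_inner punctured_orthant_add inner_add_right)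

lemma l1_norm_add_pos:
  "x \<in> punctured_orthant \<Longrightarrow> y \<in> punctured_orthant \<Longrightarrow> 0 < l1_norm x + l1_norm y"
  by (intro add_pos_pos l1_norm_pos)

lemma punctured_orthant_scaleR:
  "x \<in> punctured_orthant \<Longrightarrow> 0 < r \<Longrightarrow> r *\<^sub>R x \<in> punctured_orthant"
  by (auto simp: punctured_orthant_def)

lemma l1_norm_scaleR: "l1_norm (r *\<^sub>R x) = \<bar>r\<bar> * l1_norm x"
  by (simp add: l1_norm_def abs_mult sum_distrib_left)

lemma continuous_on_l1_norm [continuous_intros]:
  "continuous_on S f \<Longrightarrow> continuous_on S (\<lambda>x. l1_norm (f x))"
  unfolding l1_norm_def by (intro continuous_intros)

text \<open>Within the orthant the norm coincides with the linear functional
  \<open>One \<bullet> x\<close>. It therefore has a derivative there even on the boundary faces,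
  where the absolute values have kinks in the full space.\<close>

lemma has_derivative_l1_norm:
  assumes "x \<in> punctured_orthant"
  shows "(l1_norm has_derivative (\<lambda>h. One \<bullet> h)) (at x within punctured_orthant)"
proof -
  have "((\<lambda>x. One \<bullet> x) has_derivative (\<lambda>h. One \<bullet> h)) (at x within punctured_orthant)"
    by (auto intro!: derivative_eq_intros)
  then show ?thesis
    by (rule has_derivative_transform[OF assms, rotated]) (simp add: l1_norm_eq_inner)
qed

text \<open>Supplies a direction in the degenerate case where the profile is the zero measure; any
  basis vector serves.\<close>

lemma unit_simplex_nonempty: "\<exists>\<theta>::'a::euclidean_space. \<theta> \<in> unit_simplex"
proof -
  obtain b :: 'a where b: "b \<in> Basis"
    using nonempty_Basis by blast
  then have "b \<in> punctured_orthant"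
    by (auto simp: punctured_orthant_def inner_Basis nonzero_Basis)
  moreover have "l1_norm b = 1"
    using b calculation by (simp add: l1_norm_eq_inner inner_sum_left inner_Basis)
  ultimately show ?thesis
    by (auto simp: unit_simplex_def)
qed

lemma closed_orthant: "closed {x::'a::euclidean_space. \<forall>b\<in>Basis. 0 \<le> x \<bullet> b}"
proof -
  have "{x::'a. \<forall>b\<in>Basis. 0 \<le> x \<bullet> b} = (\<Inter>b\<in>Basis. {x. 0 \<le> x \<bullet> b})"
    by auto
  also have "closed \<dots>"
    by (intro closed_INT ballI closed_Collect_le continuous_intros)
  finally show ?thesis .
qed

lemma compact_in_sets_restrict_space:
  fixes C :: "'a::t2_space set"
  assumes "compact C" "C \<subseteq> X"
  shows "C \<in> sets (restrict_space borel X)"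
proof -
  have "C = X \<inter> C" using assms(2) by auto
  moreover have "C \<in> sets borel" using assms(1) by (rule borel_compact)
  ultimately show ?thesis
    unfolding sets_restrict_space by blast
qed

text \<open>Since \<open>C\<close> avoids 0, removing the origin changes nothing: the shell is the
  intersection of the closed orthant with a closed preimage, and \<open>norm_le_l1_norm\<close>
  bounds it.\<close>

lemma compact_l1_shell:
  assumes "compact C" "C \<subseteq> {0<..}"
  shows "compact {x \<in> punctured_orthant. l1_norm x \<in> C}"
proof -
  have eq: "{x \<in> punctured_orthant. l1_norm x \<in> C} =
      {x. \<forall>b\<in>Basis. 0 \<le> x \<bullet> b} \<inter> l1_norm -` C"
    using assms(2) by (auto simp: punctured_orthant_def l1_norm_def)
  have "closed (l1_norm -` C)"
    using assms(1) by (intro closed_vimage compact_imp_closed continuous_intros)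
  then have "closed {x \<in> punctured_orthant. l1_norm x \<in> C}"
    unfolding eq by (intro closed_Int closed_orthant)
  moreover obtain B where B: "\<And>s. s \<in> C \<Longrightarrow> norm s \<le> B"
    using compact_imp_bounded[OF assms(1)] unfolding bounded_iff by blast
  have "bounded {x \<in> punctured_orthant. l1_norm x \<in> C}"
    unfolding bounded_iff
  proof (intro exI ballI)
    fix x
    assume "x \<in> {x \<in> punctured_orthant. l1_norm x \<in> C}"
    then show "norm x \<le> B"
      using B[of "l1_norm x"] norm_le_l1_norm[of x] by auto
  qed
  ultimately show ?thesis
    by (simp add: compact_eq_bounded_closed)
qed

subsection \<open>Kernel bounds\<close>

text \<open>A majorant in one variable: its integral against the profile is finite by the mass and
  moment conditions, and products of two weights dominate the kernel multiplied by the smaller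
  size.\<close>

definition weight :: "real \<Rightarrow> real \<Rightarrow> real" where
  "weight p s = s + (if s < 1 then s powr (1 - p) else 0)"

lemma weight_nonneg: "0 \<le> s \<Longrightarrow> 0 \<le> weight p s"
  by (simp add: weight_def)

lemma weight_measurable [measurable]: "weight p \<in> borel_measurable borel"
  unfolding weight_def[abs_def] by measurable

text \<open>Both ratios \<open>s / (s + t)\<close> and \<open>t / (s + t)\<close> contribute a
  factor \<open>(s + t) powr p\<close>, which separates the singularities in \<open>s\<close> and in
  \<open>t\<close> from the dependence on the total size.\<close>

lemma Phi_ratio:
  assumes "0 < s" "0 < t"
  shows "(s + t) powr \<gamma> * Phi p (s / (s + t)) = (s + t) powr (\<gamma> + 2 * p) * s powr (- p) * t powr (- p)"
proof -
  have "1 - s / (s + t) = t / (s + t)"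
    using assms by (simp add: field_simps)
  then have "Phi p (s / (s + t)) = s powr (- p) * t powr (- p) * ((s + t) powr p * (s + t) powr p)"
    using assms by (simp add: Phi_def powr_divide powr_minus field_simps)
  moreover have "(s + t) powr (\<gamma> + 2 * p) = (s + t) powr \<gamma> * ((s + t) powr p * (s + t) powr p)"
    by (simp flip: powr_add add: algebra_simps)
  ultimately show ?thesis
    by simp
qed

text \<open>For \<open>s \<le> t\<close> the total size is at most \<open>2 * t\<close> and
  \<open>\<gamma> + 2 * p\<close> is nonnegative, so up to a constant the left side is at most
  \<open>t powr (\<gamma> + p) * s powr (1 - p)\<close>. It remains to compare the power of the
  larger size with \<open>t\<close> and the power of the smaller one with
  \<open>weight p s\<close>.\<close>

lemma powr_product_le_weight_ordered:
  fixes s t :: real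
  assumes st: "0 < s" "s \<le> t" and \<delta>: "\<delta> \<le> s + t" "0 < \<delta>" "\<delta> \<le> 1"
    and par: "0 \<le> \<gamma> + 2 * p" "\<gamma> + p < 1" "\<gamma> < 1"
  shows "(s + t) powr (\<gamma> + 2 * p) * s powr (- p) * t powr (- p) * s
    \<le> 2 powr (\<gamma> + 2 * p) * (\<delta> / 2) powr (\<gamma> + p - 1) * (weight p s * weight p t)"
proof -
  \<comment> \<open>The larger size is at least \<open>\<delta> / 2\<close> and the exponent is
    negative, so \<open>C\<close> bounds \<open>t powr (\<gamma> + p - 1)\<close>; moreover
    \<open>\<delta> \<le> 1\<close> gives \<open>C \<ge> 1\<close>.\<close>
  define C where "C = (\<delta> / 2) powr (\<gamma> + p - 1)"
  have t: "0 < t" "\<delta> / 2 \<le> t"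
    using st \<delta> by linarith+
  have C1: "1 \<le> C"
  proof -
    have "1 powr (\<gamma> + p - 1) \<le> (\<delta> / 2) powr (\<gamma> + p - 1)"
      using \<delta> par by (intro powr_mono2') auto
    then show ?thesis by (simp add: C_def)
  qed
  have w: "0 \<le> weight p s" "0 \<le> weight p t" "s \<le> weight p s" "t \<le> weight p t"
    using st t by (auto simp: weight_def)
  have key: "t powr (\<gamma> + p) * s powr (1 - p) \<le> C * (weight p s * weight p t)"
  proof (cases "s < 1")
    case True
    have "t powr (\<gamma> + p - 1) \<le> C"
      unfolding C_def using t \<delta> par by (intro powr_mono2') auto
    then have "t powr (\<gamma> + p - 1) * t \<le> C * t"
      using t by simp
    then have "t powr (\<gamma> + p) \<le> C * t"
      using t by (simp add: powr_diff)
    also have "\<dots> \<le> C * weight p t"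
      using C1 w by simp
    finally have "t powr (\<gamma> + p) \<le> C * weight p t" .
    moreover have "s powr (1 - p) \<le> weight p s"
      using True st by (simp add: weight_def)
    ultimately have "t powr (\<gamma> + p) * s powr (1 - p) \<le> (C * weight p t) * weight p s"
      using C1 w by (intro mult_mono) auto
    then show ?thesis by (simp add: mult_ac)
  next
    case False
    \<comment> \<open>For \<open>s \<ge> 1\<close> the weight of \<open>s\<close> is just
      \<open>s\<close>, so the excess factor \<open>s powr (- p)\<close> has to be absorbed by
      \<open>t\<close>. Which of \<open>\<gamma> + p < 1\<close> and \<open>\<gamma> < 1\<close>
      achieves this depends on the sign of \<open>p\<close>.\<close>
    have "s powr (- p) \<le> t powr (1 - \<gamma> - p)"
    proof (cases "0 \<le> p")
      case True
      have "s powr (- p) \<le> 1"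
        using False True powr_mono[of "- p" 0 s] by simp
      also have "1 \<le> t powr (1 - \<gamma> - p)"
        using False st par by (intro ge_one_powr_ge_zero) auto
      finally show ?thesis .
    next
      case False2: False
      have "s powr (- p) \<le> t powr (- p)"
        using False2 st by (intro powr_mono2) auto
      also have "\<dots> \<le> t powr (1 - \<gamma> - p)"
        using False st par by (intro powr_mono) auto
      finally show ?thesis .
    qed
    then have "t powr (\<gamma> + p) * (s powr (- p) * s) \<le> t powr (\<gamma> + p) * (t powr (1 - \<gamma> - p) * s)"
      using st by (intro mult_left_mono mult_right_mono) auto
    moreover have "s powr (- p) * s = s powr (1 - p)"
      using st by (simp add: powr_diff powr_minus field_simps)
    moreover have "t powr (\<gamma> + p) * t powr (1 - \<gamma> - p) = t"
      using t by (simp flip: powr_add)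
    ultimately have "t powr (\<gamma> + p) * s powr (1 - p) \<le> t * s"
      by (metis mult.assoc)
    also have "\<dots> \<le> weight p t * weight p s"
      using w st t by (intro mult_mono) auto
    also have "\<dots> \<le> C * (weight p s * weight p t)"
      using C1 w mult_right_mono[of 1 C "weight p s * weight p t"] by (simp add: mult.commute)
    finally show ?thesis .
  qed
  have "(s + t) powr (\<gamma> + 2 * p) \<le> (2 * t) powr (\<gamma> + 2 * p)"
    using st par by (intro powr_mono2) auto
  also have "\<dots> = 2 powr (\<gamma> + 2 * p) * t powr (\<gamma> + 2 * p)"
    using t by (simp add: powr_mult)
  finally have "(s + t) powr (\<gamma> + 2 * p) * (s powr (- p) * t powr (- p) * s)
      \<le> (2 powr (\<gamma> + 2 * p) * t powr (\<gamma> + 2 * p)) * (s powr (- p) * t powr (- p) * s)"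
    using st by (intro mult_right_mono) auto
  also have "\<dots> = 2 powr (\<gamma> + 2 * p) * (t powr (\<gamma> + p) * s powr (1 - p))"
  proof -
    have "t powr (\<gamma> + 2 * p) * t powr (- p) = t powr (\<gamma> + p)"
      using t by (simp flip: powr_add add: algebra_simps)
    moreover have "s powr (- p) * s = s powr (1 - p)"
      using st by (simp add: powr_diff powr_minus field_simps)
    moreover have "(2 powr (\<gamma> + 2 * p) * t powr (\<gamma> + 2 * p)) * (s powr (- p) * t powr (- p) * s) =
        2 powr (\<gamma> + 2 * p) * ((t powr (\<gamma> + 2 * p) * t powr (- p)) * (s powr (- p) * s))"
      by (simp only: mult_ac)
    ultimately show ?thesis
      by simp
  qed
  also have "\<dots> \<le> 2 powr (\<gamma> + 2 * p) * (C * (weight p s * weight p t))"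
    using key by (intro mult_left_mono) auto
  finally show ?thesis
    by (simp add: C_def mult_ac)
qed

lemma powr_product_le_weight:
  fixes s t :: real
  assumes st: "0 < s" "0 < t" and \<delta>: "\<delta> \<le> s + t" "0 < \<delta>" "\<delta> \<le> 1"
    and par: "0 \<le> \<gamma> + 2 * p" "\<gamma> + p < 1" "\<gamma> < 1"
  shows "(s + t) powr (\<gamma> + 2 * p) * s powr (- p) * t powr (- p) * min s t
    \<le> 2 powr (\<gamma> + 2 * p) * (\<delta> / 2) powr (\<gamma> + p - 1) * (weight p s * weight p t)"
proof (cases "s \<le> t")
  case True
  then show ?thesis
    using powr_product_le_weight_ordered[of s t \<delta> \<gamma> p] assms by (simp add: min_def)
next
  case False
  then show ?thesis
    using powr_product_le_weight_ordered[of t s \<delta> \<gamma> p] assms by (simp add: min_def mult_ac add_ac)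
qed

text \<open>The lower kernel bound enters here: strict positivity later allows the kernel to be
  divided out of a vanishing integrand.\<close>

lemma kernel_pos:
  assumes "coagulation_kernel \<gamma> p c\<^sub>1 c\<^sub>2 K" "x \<in> punctured_orthant" "y \<in> punctured_orthant"
  shows "0 < K x y"
proof -
  have "0 < l1_norm x" "0 < l1_norm y"
    using assms l1_norm_pos by blast+
  then have "0 < c\<^sub>1 * ((l1_norm x + l1_norm y) powr \<gamma> * Phi p (l1_norm x / (l1_norm x + l1_norm y)))"
    using assms(1) by (simp add: Phi_ratio coagulation_kernel_def)
  also have "\<dots> \<le> K x y"
    using assms by (simp add: coagulation_kernel_def mult_ac)
  finally show ?thesis .
qed

text \<open>One factor of the smaller size tames the kernel as soon as the total size stays above
  \<open>\<delta>\<close>. What remains is a product of weights, integrable against the product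
  measure.\<close>

lemma kernel_min_le_weight:
  assumes K: "coagulation_kernel \<gamma> p c\<^sub>1 c\<^sub>2 K" and xy: "x \<in> punctured_orthant" "y \<in> punctured_orthant"
    and \<delta>: "\<delta> \<le> l1_norm x + l1_norm y" "0 < \<delta>" "\<delta> \<le> 1"
  shows "K x y * min (l1_norm x) (l1_norm y)
    \<le> c\<^sub>2 * (2 powr (\<gamma> + 2 * p) * (\<delta> / 2) powr (\<gamma> + p - 1)) * (weight p (l1_norm x) * weight p (l1_norm y))"
proof -
  let ?s = "l1_norm x" and ?t = "l1_norm y"
  have st: "0 < ?s" "0 < ?t"
    using xy l1_norm_pos by blast+
  have par: "0 \<le> \<gamma> + 2 * p" "\<gamma> + p < 1" "\<gamma> < 1" "0 < c\<^sub>2"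
    using K by (auto simp: coagulation_kernel_def)
  have "K x y \<le> c\<^sub>2 * ((?s + ?t) powr \<gamma> * Phi p (?s / (?s + ?t)))"
    using K xy by (simp add: coagulation_kernel_def mult.assoc)
  then have "K x y * min ?s ?t \<le> c\<^sub>2 * ((?s + ?t) powr \<gamma> * Phi p (?s / (?s + ?t))) * min ?s ?t"
    using st by (intro mult_right_mono) auto
  also have "\<dots> = c\<^sub>2 * ((?s + ?t) powr (\<gamma> + 2 * p) * ?s powr (- p) * ?t powr (- p) * min ?s ?t)"
    using st by (simp add: Phi_ratio mult.assoc)
  also have "\<dots> \<le> c\<^sub>2 * (2 powr (\<gamma> + 2 * p) * (\<delta> / 2) powr (\<gamma> + p - 1) * (weight p ?s * weight p ?t))"
    using powr_product_le_weight[OF st \<delta> par(1-3)] par by (intro mult_left_mono) auto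
  finally show ?thesis
    by (simp add: mult.assoc)
qed

subsection \<open>The cutoff\<close>

text \<open>The expression inside the maximum is concave on the half line, rises up to
  \<open>s = 1\<close>, falls afterwards, and tends to 1 as \<open>n\<close> grows. It is negative
  outside \<open>{1 / n..n}\<close>, hence the truncation at 0.\<close>

definition ramp :: "real \<Rightarrow> real \<Rightarrow> real" where
  "ramp n s = max 0 (1 - 1 / (n * s) - s / n)"

text \<open>Squaring removes the corners of \<open>ramp\<close> where it reaches 0, so that the
  cutoff is continuously differentiable.\<close>

definition cutoff :: "real \<Rightarrow> real \<Rightarrow> real" where
  "cutoff n s = (ramp n s)\<^sup>2"

definition cutoff_deriv :: "real \<Rightarrow> real \<Rightarrow> real" where
  "cutoff_deriv n s = 2 * ramp n s * (1 / (n * s\<^sup>2) - 1 / n)"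

lemma ramp_range: "0 < n \<Longrightarrow> 0 < s \<Longrightarrow> 0 \<le> ramp n s \<and> ramp n s \<le> 1"
proof -
  assume "0 < n" "0 < s"
  then have "0 \<le> 1 / (n * s)" "0 \<le> s / n"
    by auto
  then show ?thesis
    unfolding ramp_def by linarith
qed

lemma cutoff_range: "0 < n \<Longrightarrow> 0 < s \<Longrightarrow> 0 \<le> cutoff n s \<and> cutoff n s \<le> 1"
  using ramp_range[of n s] by (auto simp: cutoff_def power_le_one)

lemma ramp_eq_0:
  assumes "0 < n" "0 < s" "s \<notin> {1 / n..n}"
  shows "ramp n s = 0"
proof -
  consider "s < 1 / n" | "n < s"
    using assms by fastforce
  then have "1 \<le> 1 / (n * s) + s / n"
  proof cases
    case 1
    then have "1 \<le> 1 / (n * s)" using assms by (simp add: field_simps)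
    moreover have "0 \<le> s / n" using assms by simp
    ultimately show ?thesis by linarith
  next
    case 2
    then have "1 \<le> s / n" using assms by (simp add: field_simps)
    moreover have "0 \<le> 1 / (n * s)" using assms by simp
    ultimately show ?thesis by linarith
  qed
  then show ?thesis
    by (simp add: ramp_def max_def)
qed

lemma ramp_increment:
  fixes n s t :: real
  assumes "0 < n" "0 < s" "0 < t"
  shows "(1 - 1 / (n * (s + t)) - (s + t) / n) - (1 - 1 / (n * s) - s / n)
    = t / (n * s * (s + t)) - t / n"
proof -
  have "1 / (n * s) - 1 / (n * (s + t)) = t / (n * s * (s + t))"
    using assms by (simp add: divide_simps)
  then show ?thesis
    by (simp add: add_divide_distrib)
qed

text \<open>The increase is at most \<open>t / (n * s * (s + t))\<close>; multiplication by
  \<open>s\<close> and \<open>n * (s + t) \<ge> 1\<close> leave \<open>t\<close>.\<close>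

lemma ramp_increase_le:
  assumes "0 < n" "0 < s" "0 < t" "1 / n \<le> s + t"
  shows "s * (ramp n (s + t) - ramp n s) \<le> t"
proof -
  have "ramp n (s + t) - ramp n s \<le> max 0 (t / (n * s * (s + t)) - t / n)"
    using ramp_increment[OF assms(1-3)] unfolding ramp_def by (simp add: max_def)
  also have "\<dots> \<le> t / (n * s * (s + t))"
    using assms by simp
  finally have "s * (ramp n (s + t) - ramp n s) \<le> s * (t / (n * s * (s + t)))"
    using assms by (intro mult_left_mono) auto
  also have "\<dots> = t / (n * (s + t))"
    using assms by simp
  also have "\<dots> \<le> t / 1"
    using assms by (intro divide_left_mono) (auto simp: field_simps)
  finally show ?thesis by simp
qed

text \<open>The slope inside the maximum is never below \<open>- 1 / n\<close>, which gives the
  first bound. The second follows for \<open>s \<le> n\<close>, while beyond \<open>n\<close> the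
  ramp is already 0 and cannot decrease. The third holds because the turning point is
  \<open>s = 1\<close> for every \<open>n\<close>.\<close>

lemma ramp_decrease_le:
  assumes "0 < n" "0 < s" "0 < t"
  shows "s * (ramp n s - ramp n (s + t)) \<le> s * t / n"
    and "s * (ramp n s - ramp n (s + t)) \<le> t"
    and "s + t \<le> 1 \<Longrightarrow> ramp n s \<le> ramp n (s + t)"
proof -
  have 1: "ramp n s - ramp n (s + t) \<le> max 0 (t / n - t / (n * s * (s + t)))"
    using ramp_increment[OF assms] unfolding ramp_def by (simp add: max_def)
  also have "\<dots> \<le> t / n"
    using assms by simp
  finally have 2: "s * (ramp n s - ramp n (s + t)) \<le> s * (t / n)"
    using assms by (intro mult_left_mono) auto
  then show "s * (ramp n s - ramp n (s + t)) \<le> s * t / n" by simp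
  show "s * (ramp n s - ramp n (s + t)) \<le> t"
  proof (cases "s \<le> n")
    case True
    then have "s * (t / n) \<le> t"
      using assms by (simp add: field_simps)
    with 2 show ?thesis by linarith
  next
    case False
    then have "ramp n s - ramp n (s + t) \<le> 0"
      using ramp_eq_0[of n s] ramp_range[of n "s + t"] assms by simp
    then show ?thesis
      using assms by (smt (verit) mult_nonneg_nonpos)
  qed
  assume "s + t \<le> 1"
  then have "s * (s + t) \<le> 1"
    using assms by (intro mult_le_one) auto
  then have "t / n \<le> t / n / (s * (s + t))"
    using assms by (simp add: le_divide_eq mult_left_le)
  then have "t / n - t / (n * s * (s + t)) \<le> 0"
    by (simp add: mult.assoc)
  with 1 show "ramp n s \<le> ramp n (s + t)" by simp
qed

lemma cutoff_diff_le:
  assumes "0 < n" "0 < s" "0 < t"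
  shows "\<bar>cutoff n s - cutoff n t\<bar> \<le> 2 * \<bar>ramp n s - ramp n t\<bar>"
proof -
  have "cutoff n s - cutoff n t = (ramp n s - ramp n t) * (ramp n s + ramp n t)"
    by (simp add: cutoff_def power2_eq_square algebra_simps)
  moreover have "\<bar>ramp n s + ramp n t\<bar> \<le> 2"
    using ramp_range[of n s] ramp_range[of n t] assms by linarith
  ultimately show ?thesis
    using mult_left_mono[of "\<bar>ramp n s + ramp n t\<bar>" 2 "\<bar>ramp n s - ramp n t\<bar>"]
    by (simp add: abs_mult mult.commute)
qed

text \<open>The bound by \<open>s\<close> comes from the range of the ramp, the bound by
  \<open>t\<close> from its increments; their minimum is the factor that the kernel estimate
  requires.\<close>

lemma cutoff_variation_le:
  assumes "0 < n" "0 < s" "0 < t" "1 / n \<le> s + t"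
  shows "s * \<bar>cutoff n (s + t) - cutoff n s\<bar> \<le> 2 * min s t"
proof -
  have "\<bar>ramp n (s + t) - ramp n s\<bar> \<le> 1"
    using ramp_range[of n s] ramp_range[of n "s + t"] assms by linarith
  then have "s * \<bar>ramp n (s + t) - ramp n s\<bar> \<le> s"
    using assms by (simp add: mult_le_cancel_left1)
  moreover have "s * \<bar>ramp n (s + t) - ramp n s\<bar> \<le> t"
    using ramp_increase_le[OF assms] ramp_decrease_le(2)[OF assms(1-3)]
    by (auto simp: abs_if right_diff_distrib)
  moreover have "s * \<bar>cutoff n (s + t) - cutoff n s\<bar> \<le> s * (2 * \<bar>ramp n (s + t) - ramp n s\<bar>)"
    using cutoff_diff_le[of n "s + t" s] assms by (intro mult_left_mono) auto
  ultimately show ?thesis by linarith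
qed

text \<open>The only contribution of the cutoff with the wrong sign: the positive part of its
  decrease from \<open>s\<close> to \<open>s + t\<close>, weighted by the size
  \<open>s\<close>.\<close>

definition cutoff_drop :: "real \<Rightarrow> real \<Rightarrow> real \<Rightarrow> real" where
  "cutoff_drop n s t = s * max 0 (cutoff n s - cutoff n (s + t))"

text \<open>The first bound gives pointwise convergence to 0 as \<open>n\<close> grows. The other
  two give a domination uniform in \<open>n\<close>: no drop occurs up to total size 1, and above it
  the smaller size controls the drop.\<close>

lemma cutoff_drop_le:
  assumes "0 < n" "0 < s" "0 < t"
  shows "cutoff_drop n s t \<le> 2 * (s * t / n)"
    and "1 \<le> s + t \<Longrightarrow> 1 \<le> n \<Longrightarrow> cutoff_drop n s t \<le> 2 * min s t"
    and "s + t \<le> 1 \<Longrightarrow> cutoff_drop n s t = 0"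
proof -
  show "cutoff_drop n s t \<le> 2 * (s * t / n)"
  proof (cases "ramp n s \<le> ramp n (s + t)")
    case True
    then have "cutoff n s \<le> cutoff n (s + t)"
      using ramp_range[of n s] assms by (simp add: cutoff_def power_mono)
    then show ?thesis
      using assms by (simp add: cutoff_drop_def)
  next
    case False
    then have "max 0 (cutoff n s - cutoff n (s + t)) \<le> 2 * (ramp n s - ramp n (s + t))"
      using cutoff_diff_le[of n s "s + t"] assms by auto
    then have "cutoff_drop n s t \<le> s * (2 * (ramp n s - ramp n (s + t)))"
      unfolding cutoff_drop_def using assms by (intro mult_left_mono) auto
    then show ?thesis
      using ramp_decrease_le(1)[OF assms] by linarith
  qed
  show "cutoff_drop n s t \<le> 2 * min s t" if "1 \<le> s + t" "1 \<le> n"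
  proof -
    have "1 / n \<le> 1" using that by simp
    then have "s * \<bar>cutoff n (s + t) - cutoff n s\<bar> \<le> 2 * min s t"
      using that by (intro cutoff_variation_le assms) linarith
    moreover have "cutoff_drop n s t \<le> s * \<bar>cutoff n (s + t) - cutoff n s\<bar>"
      unfolding cutoff_drop_def using assms by (intro mult_left_mono) auto
    ultimately show ?thesis by linarith
  qed
  show "cutoff_drop n s t = 0" if "s + t \<le> 1"
  proof -
    have "cutoff n s \<le> cutoff n (s + t)"
      using ramp_decrease_le(3)[OF assms that] ramp_range[of n s] assms
      by (simp add: cutoff_def power_mono)
    then show ?thesis by (simp add: cutoff_drop_def)
  qed
qed

lemma cutoff_drop_nonneg: "0 \<le> s \<Longrightarrow> 0 \<le> cutoff_drop n s t"
  by (simp add: cutoff_drop_def)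

lemma cutoff_drop_tendsto:
  assumes "0 < s" "0 < t"
  shows "(\<lambda>k. cutoff_drop (real (Suc k)) s t) \<longlonglongrightarrow> 0"
proof (rule tendsto_sandwich)
  show "\<forall>\<^sub>F k in sequentially. 0 \<le> cutoff_drop (real (Suc k)) s t"
    using assms by (simp add: cutoff_drop_nonneg)
  show "\<forall>\<^sub>F k in sequentially. cutoff_drop (real (Suc k)) s t \<le> 2 * (s * t / real (Suc k))"
    using assms by (intro always_eventually allI cutoff_drop_le(1)) auto
  show "(\<lambda>k. 2 * (s * t / real (Suc k))) \<longlonglongrightarrow> 0"
    by (intro tendsto_mult_right_zero LIMSEQ_Suc[OF lim_const_over_n])
qed auto

text \<open>Both subtracted terms of the ramp shrink as the parameter grows. This permits comparison
  of a fixed cutoff with all later ones.\<close>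

lemma cutoff_mono:
  assumes "0 < m" "m \<le> n" "0 < s"
  shows "cutoff m s \<le> cutoff n s"
proof -
  have "1 / (n * s) \<le> 1 / (m * s)" "s / n \<le> s / m"
    using assms by (auto simp: frac_le)
  then have "ramp m s \<le> ramp n s"
    unfolding ramp_def by linarith
  then show ?thesis
    using ramp_range[of m s] assms by (simp add: cutoff_def power_mono)
qed

lemma cutoff_pos:
  assumes "0 < s"
  shows "\<exists>k. 0 < cutoff (real (Suc k)) s"
proof -
  have "(\<lambda>k. 1 - (1 / s) / real (Suc k) - s / real (Suc k)) \<longlonglongrightarrow> 1 - 0 - 0"
    by (intro tendsto_intros LIMSEQ_Suc[OF lim_const_over_n])
  then have "\<forall>\<^sub>F k in sequentially. 0 < 1 - (1 / s) / real (Suc k) - s / real (Suc k)"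
    by (intro order_tendstoD(1)) auto
  then obtain k where "0 < 1 - (1 / s) / real (Suc k) - s / real (Suc k)"
    by (auto simp: eventually_sequentially)
  then have "0 < ramp (real (Suc k)) s"
    by (simp add: ramp_def mult.commute)
  then show ?thesis
    by (auto simp: cutoff_def intro!: exI[of _ k])
qed

text \<open>For all four sign combinations of \<open>x\<close> and \<open>x + h\<close> the error of
  the linear approximation is at most \<open>h\<^sup>2\<close>, so the difference quotient is within
  \<open>\<bar>h\<bar>\<close> of the claimed slope.\<close>

lemma DERIV_max_0_square:
  fixes x :: real
  shows "((\<lambda>x. (max 0 x)\<^sup>2) has_real_derivative 2 * max 0 x) (at x)"
  unfolding DERIV_def
proof (rule LIM_I)
  fix r :: real
  assume r: "0 < r"
  have "\<bar>((max 0 (x + h))\<^sup>2 - (max 0 x)\<^sup>2) / h - 2 * max 0 x\<bar> < r" if h: "h \<noteq> 0" "\<bar>h\<bar> < r" for h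
  proof -
    have "\<bar>(max 0 (x + h))\<^sup>2 - (max 0 x)\<^sup>2 - 2 * max 0 x * h\<bar> \<le> h\<^sup>2"
    proof (cases "0 \<le> x"; cases "0 \<le> x + h")
      assume *: "\<not> 0 \<le> x" "0 \<le> x + h"
      then have "(x + h)\<^sup>2 \<le> h\<^sup>2" by (intro power_mono) auto
      then show ?thesis using * by simp
    next
      assume *: "0 \<le> x" "\<not> 0 \<le> x + h"
      have "h\<^sup>2 - (- x\<^sup>2 - 2 * x * h) = (x + h)\<^sup>2"
        by (simp add: power2_eq_square algebra_simps)
      then have "- x\<^sup>2 - 2 * x * h \<le> h\<^sup>2"
        by (smt (verit) zero_le_power2)
      moreover have "0 \<le> x * (- x - 2 * h)"
        using * by (intro mult_nonneg_nonneg) auto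
      then have "0 \<le> - x\<^sup>2 - 2 * x * h"
        by (simp add: power2_eq_square algebra_simps)
      ultimately show ?thesis using * by simp
    qed (auto simp: power2_eq_square algebra_simps)
    then have "\<bar>(max 0 (x + h))\<^sup>2 - (max 0 x)\<^sup>2 - 2 * max 0 x * h\<bar> / \<bar>h\<bar> \<le> h\<^sup>2 / \<bar>h\<bar>"
      by (intro divide_right_mono) auto
    moreover have "h\<^sup>2 / \<bar>h\<bar> = \<bar>h\<bar>"
      using h by (simp add: power2_eq_square abs_if)
    moreover have "((max 0 (x + h))\<^sup>2 - (max 0 x)\<^sup>2) / h - 2 * max 0 x =
        ((max 0 (x + h))\<^sup>2 - (max 0 x)\<^sup>2 - 2 * max 0 x * h) / h"
      using h by (simp add: field_simps)
    ultimately show ?thesis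
      using h by (simp add: abs_divide)
  qed
  with r show "\<exists>d>0. \<forall>h. h \<noteq> 0 \<and> norm (h - 0) < d \<longrightarrow>
      norm (((max 0 (x + h))\<^sup>2 - (max 0 x)\<^sup>2) / h - 2 * max 0 x) < r"
    by (auto intro!: exI[of _ r])
qed

lemma DERIV_cutoff:
  assumes "0 < n" "0 < s"
  shows "(cutoff n has_real_derivative cutoff_deriv n s) (at s)"
proof -
  have "((\<lambda>s. 1 - 1 / (n * s) - s / n) has_real_derivative (1 / (n * s\<^sup>2) - 1 / n)) (at s)"
    using assms by (auto intro!: derivative_eq_intros simp: field_simps power2_eq_square)
  from DERIV_chain2[OF DERIV_max_0_square this] show ?thesis
    by (simp add: cutoff_def[abs_def] ramp_def cutoff_deriv_def)
qed

text \<open>The product is \<open>2 * ramp n s * \<bar>1 / (n * s) - s / n\<bar>\<close>. Where the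
  ramp is positive, \<open>1 / (n * s) + s / n < 1\<close>, which yields the uniform bound; bounding
  the ramp by 1 instead yields decay in \<open>n\<close>.\<close>

lemma cutoff_deriv_bound:
  assumes "0 < n" "0 < s"
  shows "s * \<bar>cutoff_deriv n s\<bar> \<le> 2"
    and "s * \<bar>cutoff_deriv n s\<bar> \<le> 2 * ((1 / s + s) / n)"
proof -
  have eq: "s * \<bar>cutoff_deriv n s\<bar> = 2 * (ramp n s * \<bar>1 / (n * s) - s / n\<bar>)"
  proof -
    have "s * cutoff_deriv n s = 2 * (ramp n s * (1 / (n * s) - s / n))"
      using assms by (simp add: cutoff_deriv_def field_simps power2_eq_square)
    then have "\<bar>s * cutoff_deriv n s\<bar> = \<bar>2 * (ramp n s * (1 / (n * s) - s / n))\<bar>"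
      by simp
    then show ?thesis
      using ramp_range[OF assms] assms by (simp add: abs_mult)
  qed
  have pos: "0 \<le> 1 / (n * s)" "0 \<le> s / n"
    using assms by auto
  show "s * \<bar>cutoff_deriv n s\<bar> \<le> 2 * ((1 / s + s) / n)"
  proof -
    have "ramp n s * \<bar>1 / (n * s) - s / n\<bar> \<le> 1 * \<bar>1 / (n * s) - s / n\<bar>"
      using ramp_range[OF assms] by (intro mult_right_mono) auto
    moreover have "\<bar>1 / (n * s) - s / n\<bar> \<le> 1 / (n * s) + s / n"
      using pos by linarith
    ultimately show ?thesis
      using eq by (simp add: add_divide_distrib mult.commute)
  qed
  show "s * \<bar>cutoff_deriv n s\<bar> \<le> 2"
  proof (cases "ramp n s = 0")
    case False
    then have "1 / (n * s) + s / n < 1"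
      unfolding ramp_def by (simp add: max_def split: if_splits)
    then have "\<bar>1 / (n * s) - s / n\<bar> \<le> 1"
      using pos by linarith
    then have "ramp n s * \<bar>1 / (n * s) - s / n\<bar> \<le> 1"
      using ramp_range[OF assms] by (intro mult_le_one) auto
    then show ?thesis using eq by simp
  next
    case True
    then have "s * \<bar>cutoff_deriv n s\<bar> = 0"
      using eq by simp
    then show ?thesis by linarith
  qed
qed

lemma continuous_on_ramp: "n \<noteq> 0 \<Longrightarrow> continuous_on {0<..} (ramp n)"
  unfolding ramp_def[abs_def] by (intro continuous_intros) auto

lemma continuous_on_cutoff: "n \<noteq> 0 \<Longrightarrow> continuous_on {0<..} (cutoff n)"
  unfolding cutoff_def[abs_def] by (intro continuous_intros continuous_on_ramp)

lemma continuous_on_cutoff_compose: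
  "n \<noteq> 0 \<Longrightarrow> continuous_on S f \<Longrightarrow> (\<And>x. x \<in> S \<Longrightarrow> 0 < f x) \<Longrightarrow> continuous_on S (\<lambda>x. cutoff n (f x))"
  by (rule continuous_on_compose2[OF continuous_on_cutoff]) auto

lemma continuous_on_cutoff_deriv: "n \<noteq> 0 \<Longrightarrow> continuous_on {0<..} (cutoff_deriv n)"
  unfolding cutoff_deriv_def[abs_def] by (intro continuous_intros continuous_on_ramp) auto

subsection \<open>The test functions\<close>

text \<open>The first factor is homogeneous of degree one and nonnegative. Its sign is what makes an
  increase of the cutoff harmless.\<close>

definition test :: "real \<Rightarrow> 'a::euclidean_space \<Rightarrow> real" where
  "test n x = (l1_norm x - norm x) * cutoff n (l1_norm x)"

definition test_grad :: "real \<Rightarrow> 'a::euclidean_space \<Rightarrow> 'a" where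
  "test_grad n x = cutoff n (l1_norm x) *\<^sub>R (One - inverse (norm x) *\<^sub>R x)
    + ((l1_norm x - norm x) * cutoff_deriv n (l1_norm x)) *\<^sub>R One"

lemma reciprocal_interval_pos: "0 < n \<Longrightarrow> {1 / n..n} \<subseteq> {0::real<..}"
  by (auto intro: less_le_trans[rotated])

lemma test_Cc1:
  assumes n: "0 < n"
  shows "Cc1_on punctured_orthant (test n) (test_grad n)"
  unfolding Cc1_on_def
proof (intro conjI ballI)
  fix x :: 'a
  assume x: "x \<in> punctured_orthant"
  then have x0: "x \<noteq> 0" and s: "0 < l1_norm x"
    using l1_norm_pos by (auto simp: punctured_orthant_def)
  let ?O = "punctured_orthant :: 'a set"
  have norm_deriv: "(norm has_derivative (\<lambda>h. inverse (norm x) *\<^sub>R x \<bullet> h)) (at x within ?O)"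
    using has_derivative_at_withinI[OF has_derivative_norm[OF x0]]
    by (simp add: sgn_div_norm inner_commute)
  have cut_deriv: "((\<lambda>x. cutoff n (l1_norm x)) has_derivative
      (\<lambda>h. (One \<bullet> h) * cutoff_deriv n (l1_norm x))) (at x within ?O)"
    by (rule has_derivative_compose[OF has_derivative_l1_norm[OF x]
          DERIV_cutoff[OF n s, unfolded has_field_derivative_def], THEN has_derivative_eq_rhs])
       (simp add: mult.commute)
  show "(test n has_derivative (\<lambda>h. test_grad n x \<bullet> h)) (at x within ?O)"
    unfolding test_def[abs_def]
    by (rule has_derivative_eq_rhs, rule has_derivative_mult[OF has_derivative_diff[OF
          has_derivative_l1_norm[OF x] norm_deriv] cut_deriv])
       (simp add: fun_eq_iff test_grad_def inner_add_left inner_diff_left algebra_simps)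
next
  show "continuous_on punctured_orthant (test_grad n :: 'a \<Rightarrow> 'a)"
    unfolding test_grad_def
    using n l1_norm_pos
    by (intro continuous_intros continuous_on_cutoff_compose
          continuous_on_compose2[OF continuous_on_cutoff_deriv])
       (auto simp: punctured_orthant_def)
next
  let ?C = "{x \<in> punctured_orthant. l1_norm x \<in> {1 / n..n}} :: 'a set"
  have "compact ?C"
    using compact_l1_shell[OF _ reciprocal_interval_pos[OF n]] by simp
  moreover have "test n x = 0" if "x \<in> punctured_orthant - ?C" for x :: 'a
    using that n ramp_eq_0[of n "l1_norm x"] l1_norm_pos[of x] by (simp add: test_def cutoff_def)
  ultimately show "compactly_supported_on punctured_orthant (test n :: 'a \<Rightarrow> real)"
    unfolding compactly_supported_on_def by (intro exI[of _ ?C]) auto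
qed

text \<open>By Euler's identity the degree-one factor cancels in the drift, and only the derivative
  of the cutoff is left.\<close>

lemma test_drift:
  assumes "x \<in> punctured_orthant"
  shows "test n x - x \<bullet> test_grad n x
    = - ((l1_norm x - norm x) * (l1_norm x * cutoff_deriv n (l1_norm x)))"
proof -
  have "norm x \<noteq> 0"
    using assms by (auto simp: punctured_orthant_def)
  then have "x \<bullet> (inverse (norm x) *\<^sub>R x) = norm x"
    by (simp add: dot_square_norm power2_eq_square)
  moreover have "x \<bullet> One = l1_norm x"
    using l1_norm_eq_inner[OF assms] by (simp add: inner_commute)
  ultimately show ?thesis
    by (simp only: test_def test_grad_def inner_add_right inner_diff_right inner_scaleR_right)
       (simp add: algebra_simps)
qed

text \<open>The degree-one factor lies between 0 and the \<open>l1\<close> norm. The first bound is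
  a majorant integrable by finite mass, the second gives the pointwise limit 0.\<close>

lemma test_drift_bound:
  assumes "x \<in> punctured_orthant" "0 < n"
  shows "\<bar>test n x - x \<bullet> test_grad n x\<bar> \<le> 2 * l1_norm x"
    and "\<bar>test n x - x \<bullet> test_grad n x\<bar> \<le> l1_norm x * (2 * ((1 / l1_norm x + l1_norm x) / n))"
proof -
  have s: "0 < l1_norm x"
    using assms l1_norm_pos by blast
  have eq: "\<bar>test n x - x \<bullet> test_grad n x\<bar> =
      (l1_norm x - norm x) * (l1_norm x * \<bar>cutoff_deriv n (l1_norm x)\<bar>)"
    using s norm_le_l1_norm[of x] by (simp add: test_drift[OF assms(1)] abs_mult)
  show "\<bar>test n x - x \<bullet> test_grad n x\<bar> \<le> 2 * l1_norm x"
    "\<bar>test n x - x \<bullet> test_grad n x\<bar> \<le> l1_norm x * (2 * ((1 / l1_norm x + l1_norm x) / n))"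
    unfolding eq mult.commute[of 2 "l1_norm x"]
    using s norm_le_l1_norm[of x]
    by (intro mult_mono cutoff_deriv_bound[OF assms(2) s]; simp)+
qed

section \<open>The coagulation bracket of the test function\<close>

definition bracket :: "('a::euclidean_space \<Rightarrow> real) \<Rightarrow> 'a \<Rightarrow> 'a \<Rightarrow> real" where
  "bracket \<psi> x y = \<psi> (x + y) - \<psi> x - \<psi> y"

text \<open>For the Euclidean norm this vanishes exactly when one argument is a nonnegative multiple
  of the other.\<close>

definition triangle_defect :: "'a::euclidean_space \<Rightarrow> 'a \<Rightarrow> real" where
  "triangle_defect x y = norm x + norm y - norm (x + y)"

lemma triangle_defect_range:
  "0 \<le> triangle_defect x y" "triangle_defect x y \<le> 2 * min (l1_norm x) (l1_norm y)"
proof -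
  show "0 \<le> triangle_defect x y"
    using norm_triangle_ineq[of x y] by (simp add: triangle_defect_def)
  have "norm y \<le> norm (x + y) + norm x" "norm x \<le> norm (x + y) + norm y"
    using norm_triangle_ineq4[of "x + y" x] norm_triangle_ineq4[of "x + y" y] by auto
  then show "triangle_defect x y \<le> 2 * min (l1_norm x) (l1_norm y)"
    using norm_le_l1_norm[of x] norm_le_l1_norm[of y] by (simp add: triangle_defect_def min_def)
qed

text \<open>Since the \<open>l1\<close> norm is additive on the orthant, freezing the cutoff at the
  total size leaves only the Euclidean defect; the last two terms correct for the cutoff at the
  individual sizes.\<close>

lemma bracket_test:
  assumes "x \<in> punctured_orthant" "y \<in> punctured_orthant"
  shows "bracket (test n) x y = triangle_defect x y * cutoff n (l1_norm x + l1_norm y)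
    + (l1_norm x - norm x) * (cutoff n (l1_norm x + l1_norm y) - cutoff n (l1_norm x))
    + (l1_norm y - norm y) * (cutoff n (l1_norm x + l1_norm y) - cutoff n (l1_norm y))"
  using l1_norm_add[OF assms]
  by (simp add: bracket_def test_def triangle_defect_def algebra_simps)

lemma cutoff_eq_0_below:
  "0 < n \<Longrightarrow> 0 < s \<Longrightarrow> s < 1 / n \<Longrightarrow> cutoff n s = 0"
  using ramp_eq_0[of n s] by (simp add: cutoff_def)

lemma bracket_test_eq_0:
  assumes "x \<in> punctured_orthant" "y \<in> punctured_orthant" "0 < n" "l1_norm x + l1_norm y < 1 / n"
  shows "bracket (test n) x y = 0"
proof -
  have "0 < l1_norm x" "0 < l1_norm y"
    using assms l1_norm_pos by blast+
  then show ?thesis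
    using assms by (simp add: bracket_test cutoff_eq_0_below)
qed

text \<open>Each of the three terms of \<open>bracket_test\<close> is at most twice the smaller
  size. The variation estimates need total size at least \<open>1 / n\<close>; below this threshold
  the whole bracket vanishes.\<close>

lemma bracket_test_bound:
  assumes xy: "x \<in> punctured_orthant" "y \<in> punctured_orthant" and n: "0 < n"
  shows "\<bar>bracket (test n) x y\<bar> \<le> 6 * min (l1_norm x) (l1_norm y)"
proof (cases "l1_norm x + l1_norm y < 1 / n")
  case True
  then show ?thesis
    using bracket_test_eq_0[OF xy n] l1_norm_pos[OF xy(1)] l1_norm_pos[OF xy(2)] by simp
next
  case False
  let ?s = "l1_norm x" and ?t = "l1_norm y"
  have st: "0 < ?s" "0 < ?t"
    using xy l1_norm_pos by blast+
  have part: "\<bar>(l1_norm z - norm z) * (cutoff n (?s + ?t) - cutoff n (l1_norm z))\<bar>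
      \<le> l1_norm z * \<bar>cutoff n (?s + ?t) - cutoff n (l1_norm z)\<bar>" for z :: 'a
    unfolding abs_mult using norm_le_l1_norm[of z] by (intro mult_right_mono) auto
  have "\<bar>triangle_defect x y * cutoff n (?s + ?t)\<bar> \<le> 2 * min ?s ?t * 1"
    unfolding abs_mult using triangle_defect_range[of x y] cutoff_range[OF n, of "?s + ?t"] st
    by (intro mult_mono) auto
  moreover have "?s * \<bar>cutoff n (?s + ?t) - cutoff n ?s\<bar> \<le> 2 * min ?s ?t"
    using cutoff_variation_le[OF n st] False by simp
  moreover have "?t * \<bar>cutoff n (?s + ?t) - cutoff n ?t\<bar> \<le> 2 * min ?s ?t"
    using cutoff_variation_le[OF n st(2,1)] False by (simp add: add.commute min.commute)
  ultimately show ?thesis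
    using part[of x] part[of y] bracket_test[OF xy, of n] by linarith
qed

text \<open>The cutoff differences carry the nonnegative coefficient
  \<open>l1_norm z - norm z\<close>. Increases can thus be discarded, and decreases cost at most the
  drop.\<close>

lemma bracket_test_lower:
  assumes "x \<in> punctured_orthant" "y \<in> punctured_orthant"
  shows "triangle_defect x y * cutoff n (l1_norm x + l1_norm y)
    \<le> bracket (test n) x y + cutoff_drop n (l1_norm x) (l1_norm y) + cutoff_drop n (l1_norm y) (l1_norm x)"
proof -
  have part: "- ((l1_norm z - norm z) * (c - d)) \<le> l1_norm z * max 0 (d - c)" for z :: 'a and c d
  proof -
    have "(l1_norm z - norm z) * (d - c) \<le> (l1_norm z - norm z) * max 0 (d - c)"
      using norm_le_l1_norm[of z] by (intro mult_left_mono) auto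
    also have "\<dots> \<le> l1_norm z * max 0 (d - c)"
      by (intro mult_right_mono) auto
    finally show ?thesis
      by (simp add: algebra_simps)
  qed
  show ?thesis
    using part[of x "cutoff n (l1_norm x + l1_norm y)" "cutoff n (l1_norm x)"]
      part[of y "cutoff n (l1_norm x + l1_norm y)" "cutoff n (l1_norm y)"]
    unfolding bracket_test[OF assms] cutoff_drop_def add.commute[of "l1_norm y" "l1_norm x"]
    by linarith
qed

text \<open>Lifts test functions of the one-component equation to the orthant: the \<open>l1\<close>
  norm is linear there, and shells over compact sets of sizes are compact.\<close>

lemma Cc1_radial:
  assumes "Cc1_on punctured_orthant \<phi> D"
  shows "Cc1_on punctured_orthant (\<lambda>x::'a::euclidean_space. \<phi> (l1_norm x)) (\<lambda>x. D (l1_norm x) *\<^sub>R One)"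
  unfolding Cc1_on_def
proof (intro conjI ballI)
  fix x :: 'a
  assume x: "x \<in> punctured_orthant"
  then have s: "l1_norm x \<in> {0<..}"
    using l1_norm_pos by auto
  then have "(\<phi> has_derivative (\<lambda>h. D (l1_norm x) * h)) (at (l1_norm x) within {0<..})"
    using assms by (simp add: Cc1_on_def punctured_orthant_real)
  \<comment> \<open>The half line is open, so the derivative within it is the unrestricted one that
    the chain rule asks for.\<close>
  then have "(\<phi> has_derivative (\<lambda>h. D (l1_norm x) * h)) (at (l1_norm x))"
    unfolding at_within_open[OF s open_greaterThan] .
  from has_derivative_compose[OF has_derivative_l1_norm[OF x] this]
  show "((\<lambda>x. \<phi> (l1_norm x)) has_derivative (\<lambda>h. D (l1_norm x) *\<^sub>R One \<bullet> h)) (at x within punctured_orthant)"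
    by simp
next
  have D: "continuous_on {0<..} D"
    using assms by (simp add: Cc1_on_def punctured_orthant_real)
  show "continuous_on punctured_orthant (\<lambda>x::'a. D (l1_norm x) *\<^sub>R One)"
    by (intro continuous_intros continuous_on_compose2[OF D]) (auto dest: l1_norm_pos)
next
  obtain C where C: "compact C" "C \<subseteq> {0<..}" "\<And>s. s \<in> {0<..} - C \<Longrightarrow> \<phi> s = 0"
    using assms unfolding Cc1_on_def compactly_supported_on_def punctured_orthant_real by blast
  show "compactly_supported_on punctured_orthant (\<lambda>x::'a. \<phi> (l1_norm x))"
    unfolding compactly_supported_on_def
    using compact_l1_shell[OF C(1,2)]
    by (intro exI[of _ "{x \<in> punctured_orthant. l1_norm x \<in> C}"]) (auto dest: l1_norm_pos intro: C(3))
qed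

lemma continuous_on_triangle_defect:
  "continuous_on S (\<lambda>z. triangle_defect (fst z) (snd z))"
  unfolding triangle_defect_def by (intro continuous_intros)

lemma continuous_on_bracket:
  assumes "continuous_on punctured_orthant \<psi>"
  shows "continuous_on (punctured_orthant \<times> punctured_orthant) (\<lambda>z. bracket \<psi> (fst z) (snd z))"
  unfolding bracket_def
  by (intro continuous_intros continuous_on_compose2[OF assms]) (auto intro: punctured_orthant_add)

lemma Cc1_continuous: "Cc1_on S \<psi> D \<Longrightarrow> continuous_on S \<psi>"
  by (auto simp: Cc1_on_def intro: has_derivative_continuous_on)

subsection \<open>Integration against a profile\<close>

lemma measurable_half_line:
  fixes f :: "real \<Rightarrow> real"
  shows "continuous_on {0<..} f \<Longrightarrow> f \<in> borel_measurable (restrict_space borel punctured_orthant)"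
  unfolding punctured_orthant_real by (rule borel_measurable_continuous_on_restrict)

locale profile =
  fixes \<gamma> p c\<^sub>1 c\<^sub>2 :: real and K :: "'a::euclidean_space \<Rightarrow> 'a \<Rightarrow> real" and F :: "'a measure"
  assumes kernel: "coagulation_kernel \<gamma> p c\<^sub>1 c\<^sub>2 K"
    and profile: "self_similar_profile \<gamma> p K F"
begin

lemma radon: "radon_measure_on punctured_orthant F"
  using profile by (simp add: self_similar_profile_def)

lemma sets_F: "sets F = sets (restrict_space borel punctured_orthant)"
  using radon by (simp add: radon_measure_on_def)

lemma space_F: "space F = punctured_orthant"
  using sets_eq_imp_space_eq[OF sets_F] by (simp add: space_restrict_space)

lemma measurable_F:
  "continuous_on punctured_orthant f \<Longrightarrow> f \<in> borel_measurable F"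
  using borel_measurable_continuous_on_restrict measurable_cong_sets[OF sets_F refl] by blast

lemma l1_norm_measurable_F [measurable]: "l1_norm \<in> borel_measurable F"
  by (intro measurable_F continuous_intros)

text \<open>Compact shells with sizes between \<open>1 / real (Suc k)\<close> and
  \<open>real (Suc k)\<close> exhaust the punctured orthant, and a Radon measure is finite on
  each.\<close>

sublocale base: sigma_finite_measure F
proof
  let ?C = "\<lambda>k::nat. {x \<in> punctured_orthant. l1_norm x \<in> {1 / real (Suc k)..real (Suc k)}}"
  have C: "compact (?C k :: 'a set)" for k
    using compact_l1_shell[OF _ reciprocal_interval_pos[of "real (Suc k)"]] by simp
  have fin: "emeasure F (?C k) \<noteq> \<infinity>" for k
  proof -
    have "?C k \<subseteq> punctured_orthant" by auto
    then have "emeasure F (?C k) < \<infinity>"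
      using C[of k] radon unfolding radon_measure_on_def by blast
    then show ?thesis by simp
  qed
  have cover: "x \<in> (\<Union>k. ?C k)" if x: "x \<in> punctured_orthant" for x :: 'a
  proof -
    have s: "0 < l1_norm x" using x l1_norm_pos by blast
    obtain i where i: "inverse (real (Suc i)) < l1_norm x"
      using reals_Archimedean[OF s] by blast
    obtain j where j: "l1_norm x < real j"
      using reals_Archimedean2 by blast
    have "1 / real (Suc (max i j)) \<le> 1 / real (Suc i)"
      by (intro divide_left_mono) auto
    then have "x \<in> ?C (max i j)"
      using x i j by (auto simp: inverse_eq_divide)
    then show ?thesis by blast
  qed
  have sets: "?C k \<in> sets F" for k
    unfolding sets_F using C[of k] by (intro compact_in_sets_restrict_space) auto
  have "(\<Union>k. ?C k) = space F"
    using cover by (auto simp: space_F)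
  then show "\<exists>A. countable A \<and> A \<subseteq> sets F \<and> \<Union>A = space F \<and> (\<forall>a\<in>A. emeasure F a \<noteq> \<infinity>)"
    using sets fin by (intro exI[of _ "range ?C"]) blast
qed

sublocale pair_sigma_finite F F ..

text \<open>By second countability the identity from the product sigma-algebra to the Borel sets of
  the product is measurable, so continuity on the product set suffices.\<close>

lemma measurable_pair_F:
  assumes "continuous_on (punctured_orthant \<times> punctured_orthant) f"
  shows "f \<in> borel_measurable (F \<Otimes>\<^sub>M F)"
proof -
  have id_F: "(\<lambda>x. x) \<in> borel_measurable F"
    by (intro measurable_F continuous_intros)
  have "(\<lambda>z. (fst z, snd z)) \<in> borel_measurable (F \<Otimes>\<^sub>M F)"
    by (intro borel_measurable_Pair measurable_compose[OF measurable_fst id_F]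
        measurable_compose[OF measurable_snd id_F])
  then have "(\<lambda>z. z) \<in> measurable (F \<Otimes>\<^sub>M F) (restrict_space borel (punctured_orthant \<times> punctured_orthant))"
    by (intro measurable_restrict_space2) (auto simp: space_pair_measure space_F)
  from measurable_compose[OF this borel_measurable_continuous_on_restrict[OF assms]]
  show ?thesis .
qed

text \<open>The two summands of \<open>weight\<close> are the mass and the moment near the origin
  from the definition of a profile.\<close>

lemma integrable_weight: "integrable F (\<lambda>x. weight p (l1_norm x))"
proof -
  have fin: "(\<integral>\<^sup>+x. ennreal (l1_norm x powr (1 - p)) * indicator {x. l1_norm x < 1} x \<partial>F) < \<infinity>"
    "(\<integral>\<^sup>+x. ennreal (l1_norm x) \<partial>F) < \<infinity>"
    using profile by (auto simp: self_similar_profile_def)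
  have "integrable F l1_norm"
    using fin(2) by (intro integrableI_nonneg) (auto simp: l1_norm_def sum_nonneg)
  moreover have "integrable F (\<lambda>x. l1_norm x powr (1 - p) * indicator {x. l1_norm x < 1} x)"
  proof (rule integrableI_nonneg)
    show "(\<lambda>x. l1_norm x powr (1 - p) * indicator {x. l1_norm x < 1} x) \<in> borel_measurable F"
      unfolding indicator_def of_bool_def by measurable
    show "(\<integral>\<^sup>+x. ennreal (l1_norm x powr (1 - p) * indicator {x. l1_norm x < 1} x) \<partial>F) < \<infinity>"
      using fin(1) by (simp add: ennreal_mult'' ennreal_indicator)
  qed auto
  ultimately have "integrable F (\<lambda>x. l1_norm x + l1_norm x powr (1 - p) * indicator {x. l1_norm x < 1} x)"
    by (rule Bochner_Integration.integrable_add)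
  moreover have "weight p s = s + s powr (1 - p) * of_bool (s < 1)" for s
    by (simp add: weight_def)
  ultimately show ?thesis
    by (simp add: indicator_def)
qed

lemma integrable_l1_norm: "integrable F l1_norm"
proof (rule Bochner_Integration.integrable_bound[OF integrable_weight])
  show "AE x in F. norm (l1_norm x) \<le> norm (weight p (l1_norm x))"
    by (intro AE_I2) (auto simp: weight_def space_F dest!: l1_norm_pos)
qed measurable

lemma integrable_weight_pair:
  "integrable (F \<Otimes>\<^sub>M F) (\<lambda>z. weight p (l1_norm (fst z)) * weight p (l1_norm (snd z)))"
proof (rule Fubini_integrable)
  show "integrable F (\<lambda>x. \<integral>y. norm (weight p (l1_norm (fst (x, y))) * weight p (l1_norm (snd (x, y)))) \<partial>F)"
    using integrable_weight by (simp add: abs_mult)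
  show "AE x in F. integrable F (\<lambda>y. weight p (l1_norm (fst (x, y))) * weight p (l1_norm (snd (x, y))))"
    using integrable_weight by simp
qed measurable

lemma continuous_on_kernel:
  "continuous_on (punctured_orthant \<times> punctured_orthant) (\<lambda>z. K (fst z) (snd z))"
  using kernel by (simp add: coagulation_kernel_def case_prod_beta')

lemma kernel_nonneg:
  "x \<in> punctured_orthant \<Longrightarrow> y \<in> punctured_orthant \<Longrightarrow> 0 \<le> K x y"
  using kernel by (simp add: coagulation_kernel_def)

text \<open>The constant of \<open>kernel_min_le_weight\<close>; it grows as the threshold
  \<open>\<delta>\<close> decreases, because \<open>\<gamma> + p < 1\<close>.\<close>

definition kernel_const :: "real \<Rightarrow> real" where
  "kernel_const \<delta> = c\<^sub>2 * (2 powr (\<gamma> + 2 * p) * (\<delta> / 2) powr (\<gamma> + p - 1))"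

lemma kernel_times_le_weight:
  assumes xy: "x \<in> punctured_orthant" "y \<in> punctured_orthant"
    and bound: "\<bar>f\<bar> \<le> c * min (l1_norm x) (l1_norm y)" "0 \<le> c"
    and \<delta>: "0 < \<delta>" "\<delta> \<le> 1" and supp: "l1_norm x + l1_norm y < \<delta> \<Longrightarrow> f = 0"
  shows "\<bar>K x y * f\<bar> \<le> c * kernel_const \<delta> * (weight p (l1_norm x) * weight p (l1_norm y))"
proof (cases "l1_norm x + l1_norm y < \<delta>")
  case True
  have "0 \<le> kernel_const \<delta>"
    using kernel by (simp add: kernel_const_def coagulation_kernel_def)
  moreover have "0 \<le> l1_norm x" "0 \<le> l1_norm y"
    using xy l1_norm_pos less_imp_le by blast+
  ultimately show ?thesis
    using bound(2) supp[OF True] by (simp add: weight_nonneg)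
next
  case False
  have "\<bar>K x y * f\<bar> = K x y * \<bar>f\<bar>"
    using kernel_nonneg[OF xy] by (simp add: abs_mult)
  also have "\<dots> \<le> K x y * (c * min (l1_norm x) (l1_norm y))"
    using bound(1) kernel_nonneg[OF xy] by (intro mult_left_mono)
  also have "\<dots> = c * (K x y * min (l1_norm x) (l1_norm y))"
    by simp
  also have "\<dots> \<le> c * (kernel_const \<delta> * (weight p (l1_norm x) * weight p (l1_norm y)))"
    unfolding kernel_const_def
    using kernel_min_le_weight[OF kernel xy _ \<delta>] False bound(2) by (intro mult_left_mono) auto
  finally show ?thesis
    by (simp add: mult.assoc)
qed

text \<open>The integrability criterion for all pair integrals with the kernel below: a factor
  bounded by a multiple of the smaller size and vanishing for small total size.\<close>

lemma integrable_kernel_times: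
  assumes cont: "continuous_on (punctured_orthant \<times> punctured_orthant) (\<lambda>z. f (fst z) (snd z))"
    and bound: "\<And>x y. x \<in> punctured_orthant \<Longrightarrow> y \<in> punctured_orthant \<Longrightarrow>
      \<bar>f x y\<bar> \<le> c * min (l1_norm x) (l1_norm y)" "0 \<le> c"
    and \<delta>: "0 < \<delta>" "\<delta> \<le> 1"
    and supp: "\<And>x y. x \<in> punctured_orthant \<Longrightarrow> y \<in> punctured_orthant \<Longrightarrow>
      l1_norm x + l1_norm y < \<delta> \<Longrightarrow> f x y = 0"
  shows "integrable (F \<Otimes>\<^sub>M F) (\<lambda>z. K (fst z) (snd z) * f (fst z) (snd z))"
proof (rule Bochner_Integration.integrable_bound)
  show "integrable (F \<Otimes>\<^sub>M F)
      (\<lambda>z. c * kernel_const \<delta> * (weight p (l1_norm (fst z)) * weight p (l1_norm (snd z))))"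
    using integrable_weight_pair by (rule integrable_mult_right)
  show "(\<lambda>z. K (fst z) (snd z) * f (fst z) (snd z)) \<in> borel_measurable (F \<Otimes>\<^sub>M F)"
    by (intro measurable_pair_F continuous_intros continuous_on_kernel cont)
  show "AE z in F \<Otimes>\<^sub>M F. norm (K (fst z) (snd z) * f (fst z) (snd z))
      \<le> norm (c * kernel_const \<delta> * (weight p (l1_norm (fst z)) * weight p (l1_norm (snd z))))"
  proof (rule AE_I2)
    fix z
    assume "z \<in> space (F \<Otimes>\<^sub>M F)"
    then have "fst z \<in> punctured_orthant" "snd z \<in> punctured_orthant"
      by (auto simp: space_pair_measure space_F)
    from kernel_times_le_weight[OF this bound(1)[OF this] bound(2) \<delta> supp[OF this]]
    show "norm (K (fst z) (snd z) * f (fst z) (snd z))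
        \<le> norm (c * kernel_const \<delta> * (weight p (l1_norm (fst z)) * weight p (l1_norm (snd z))))"
      by auto
  qed
qed

lemma weak_equation:
  assumes "Cc1_on punctured_orthant \<psi> D"
  shows "(\<integral>x. (\<integral>y. K x y * bracket \<psi> x y \<partial>F) \<partial>F) = - (2 / (1 - \<gamma>)) * (\<integral>x. \<psi> x - x \<bullet> D x \<partial>F)"
proof -
  have "0 = 1 / 2 * (\<integral>x. (\<integral>y. K x y * (\<psi> (x + y) - \<psi> x - \<psi> y) \<partial>F) \<partial>F)
      + 1 / (1 - \<gamma>) * (\<integral>x. \<psi> x - x \<bullet> D x \<partial>F)"
    using profile assms unfolding self_similar_profile_def by blast
  then show ?thesis
    unfolding bracket_def by simp
qed

subsection \<open>Concentration on a ray\<close>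

text \<open>The threshold is \<open>1 / n\<close>, below which the bracket vanishes. The resulting
  majorant depends on \<open>n\<close>, which is harmless since only integrability for each
  \<open>n\<close> is claimed.\<close>

lemma integrable_bracket_test:
  assumes "1 \<le> n"
  shows "integrable (F \<Otimes>\<^sub>M F) (\<lambda>z. K (fst z) (snd z) * bracket (test n) (fst z) (snd z))"
proof (rule integrable_kernel_times)
  show "continuous_on (punctured_orthant \<times> punctured_orthant) (\<lambda>z. bracket (test n) (fst z :: 'a) (snd z))"
    using assms by (intro continuous_on_bracket Cc1_continuous[OF test_Cc1]) simp
  show "0 < 1 / n" "1 / n \<le> 1"
    using assms by auto
qed (use assms in \<open>auto intro!: bracket_test_bound bracket_test_eq_0\<close>)

lemma integrable_defect:
  assumes "1 \<le> n"
  shows "integrable (F \<Otimes>\<^sub>M F)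
    (\<lambda>z. K (fst z) (snd z) * (triangle_defect (fst z) (snd z) * cutoff n (l1_norm (fst z) + l1_norm (snd z))))"
proof (rule integrable_kernel_times)
  show "continuous_on (punctured_orthant \<times> punctured_orthant)
      (\<lambda>z. triangle_defect (fst z :: 'a) (snd z) * cutoff n (l1_norm (fst z) + l1_norm (snd z)))"
    using assms
    by (intro continuous_intros continuous_on_triangle_defect continuous_on_cutoff_compose)
       (auto intro: l1_norm_add_pos dest: l1_norm_pos)
  show "0 < 1 / n" "1 / n \<le> 1"
    using assms by auto
  fix x y :: 'a
  assume xy: "x \<in> punctured_orthant" "y \<in> punctured_orthant"
  then have pos: "0 < l1_norm x + l1_norm y"
    by (rule l1_norm_add_pos)
  have "\<bar>triangle_defect x y\<bar> * \<bar>cutoff n (l1_norm x + l1_norm y)\<bar> \<le> 2 * min (l1_norm x) (l1_norm y) * 1"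
    using triangle_defect_range[of x y] cutoff_range[OF _ pos, of n] assms
    by (intro mult_mono) auto
  then show "\<bar>triangle_defect x y * cutoff n (l1_norm x + l1_norm y)\<bar> \<le> 2 * min (l1_norm x) (l1_norm y)"
    by (simp add: abs_mult)
  show "triangle_defect x y * cutoff n (l1_norm x + l1_norm y) = 0" if "l1_norm x + l1_norm y < 1 / n"
    using cutoff_eq_0_below[OF _ pos that] assms by simp
qed simp

lemma defect_nonneg:
  assumes "0 < n" "z \<in> space (F \<Otimes>\<^sub>M F)"
  shows "0 \<le> K (fst z) (snd z) * (triangle_defect (fst z) (snd z) * cutoff n (l1_norm (fst z) + l1_norm (snd z)))"
proof -
  have z: "fst z \<in> punctured_orthant" "snd z \<in> punctured_orthant"
    using assms(2) by (auto simp: space_pair_measure space_F)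
  then show ?thesis
    using kernel_nonneg[OF z] triangle_defect_range(1)[of "fst z" "snd z"]
      cutoff_range[OF assms(1) l1_norm_add_pos[OF z]]
    by simp
qed

text \<open>As the drop vanishes up to total size 1, the threshold can be 1 for every
  \<open>n\<close>. This makes the majorant independent of \<open>n\<close>, as dominated
  convergence demands.\<close>

lemma integrable_drop:
  assumes "1 \<le> n"
  shows "integrable (F \<Otimes>\<^sub>M F) (\<lambda>z. K (fst z) (snd z) * cutoff_drop n (l1_norm (fst z)) (l1_norm (snd z)))"
    (is ?A)
    and "z \<in> space (F \<Otimes>\<^sub>M F) \<Longrightarrow>
      \<bar>K (fst z) (snd z) * cutoff_drop n (l1_norm (fst z)) (l1_norm (snd z))\<bar>
        \<le> 2 * kernel_const 1 * (weight p (l1_norm (fst z)) * weight p (l1_norm (snd z)))" (is "_ \<Longrightarrow> ?B")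
proof -
  have bound: "\<bar>cutoff_drop n (l1_norm x) (l1_norm y)\<bar> \<le> 2 * min (l1_norm x) (l1_norm y)"
    and supp: "l1_norm x + l1_norm y < 1 \<Longrightarrow> cutoff_drop n (l1_norm x) (l1_norm y) = 0"
    if xy: "x \<in> punctured_orthant" "y \<in> punctured_orthant" for x y :: 'a
  proof -
    have st: "0 < l1_norm x" "0 < l1_norm y"
      using xy l1_norm_pos by blast+
    then show "l1_norm x + l1_norm y < 1 \<Longrightarrow> cutoff_drop n (l1_norm x) (l1_norm y) = 0"
      using cutoff_drop_le(3)[OF _ st] assms by simp
    then show "\<bar>cutoff_drop n (l1_norm x) (l1_norm y)\<bar> \<le> 2 * min (l1_norm x) (l1_norm y)"
      using cutoff_drop_le(2)[OF _ st] cutoff_drop_nonneg[of "l1_norm x" n "l1_norm y"] st assms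
      by (cases "l1_norm x + l1_norm y < 1") auto
  qed
  show ?A
  proof (rule integrable_kernel_times[OF _ bound _ _ _ supp])
    show "continuous_on (punctured_orthant \<times> punctured_orthant)
        (\<lambda>z. cutoff_drop n (l1_norm (fst z :: 'a)) (l1_norm (snd z :: 'a)))"
      unfolding cutoff_drop_def
      using assms
      by (intro continuous_intros continuous_on_cutoff_compose)
         (auto intro: l1_norm_add_pos dest: l1_norm_pos)
  qed auto
  show ?B if "z \<in> space (F \<Otimes>\<^sub>M F)"
  proof -
    have z: "fst z \<in> punctured_orthant" "snd z \<in> punctured_orthant"
      using that by (auto simp: space_pair_measure space_F)
    show ?thesis
      using kernel_times_le_weight[OF z bound[OF z] _ _ _ supp[OF z]] by simp
  qed
qed

lemma integral_drop_tendsto: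
  "(\<lambda>k. \<integral>z. K (fst z) (snd z) * cutoff_drop (real (Suc k)) (l1_norm (fst z)) (l1_norm (snd z)) \<partial>(F \<Otimes>\<^sub>M F))
    \<longlonglongrightarrow> 0"
proof -
  have "(\<lambda>k. \<integral>z. K (fst z) (snd z) * cutoff_drop (real (Suc k)) (l1_norm (fst z)) (l1_norm (snd z)) \<partial>(F \<Otimes>\<^sub>M F))
      \<longlonglongrightarrow> (\<integral>z. 0 \<partial>(F \<Otimes>\<^sub>M F))"
  proof (rule integral_dominated_convergence)
    show "integrable (F \<Otimes>\<^sub>M F)
        (\<lambda>z. 2 * kernel_const 1 * (weight p (l1_norm (fst z)) * weight p (l1_norm (snd z))))"
      using integrable_weight_pair by (rule integrable_mult_right)
    show "(\<lambda>z. K (fst z) (snd z) * cutoff_drop (real (Suc k)) (l1_norm (fst z)) (l1_norm (snd z)))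
        \<in> borel_measurable (F \<Otimes>\<^sub>M F)" for k
      using integrable_drop(1)[of "real (Suc k)"] by (auto intro: borel_measurable_integrable)
    show "AE z in F \<Otimes>\<^sub>M F. norm (K (fst z) (snd z) * cutoff_drop (real (Suc k)) (l1_norm (fst z)) (l1_norm (snd z)))
        \<le> 2 * kernel_const 1 * (weight p (l1_norm (fst z)) * weight p (l1_norm (snd z)))" for k
      using integrable_drop(2)[of "real (Suc k)"] by (intro AE_I2) auto
    show "AE z in F \<Otimes>\<^sub>M F. (\<lambda>k. K (fst z) (snd z)
        * cutoff_drop (real (Suc k)) (l1_norm (fst z)) (l1_norm (snd z))) \<longlonglongrightarrow> 0"
      by (intro AE_I2 tendsto_mult_right_zero cutoff_drop_tendsto l1_norm_pos)
         (auto simp: space_pair_measure space_F)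
  qed simp
  then show ?thesis by simp
qed

lemma integral_drift_tendsto:
  "(\<lambda>k. \<integral>x. test (real (Suc k)) x - x \<bullet> test_grad (real (Suc k)) x \<partial>F) \<longlonglongrightarrow> 0"
proof -
  have "(\<lambda>k. \<integral>x. test (real (Suc k)) x - x \<bullet> test_grad (real (Suc k)) x \<partial>F) \<longlonglongrightarrow> (\<integral>x. 0 \<partial>F)"
  proof (rule integral_dominated_convergence)
    show "integrable F (\<lambda>x. 2 * l1_norm x)"
      using integrable_l1_norm by (rule integrable_mult_right)
    have "Cc1_on punctured_orthant (test (real (Suc k)) :: 'a \<Rightarrow> real) (test_grad (real (Suc k)))" for k
      by (rule test_Cc1) simp
    then show "(\<lambda>x. test (real (Suc k)) x - x \<bullet> test_grad (real (Suc k)) x) \<in> borel_measurable F" for k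
      by (intro measurable_F continuous_intros Cc1_continuous[of _ _ "test_grad (real (Suc k))"])
         (auto simp: Cc1_on_def)
    show "AE x in F. norm (test (real (Suc k)) x - x \<bullet> test_grad (real (Suc k)) x) \<le> 2 * l1_norm x" for k
      using test_drift_bound(1)[of _ "real (Suc k)"] by (intro AE_I2) (auto simp: space_F)
    show "AE x in F. (\<lambda>k. test (real (Suc k)) x - x \<bullet> test_grad (real (Suc k)) x) \<longlonglongrightarrow> 0"
    proof (rule AE_I2)
      fix x
      assume "x \<in> space F"
      then have x: "x \<in> punctured_orthant" by (simp add: space_F)
      show "(\<lambda>k. test (real (Suc k)) x - x \<bullet> test_grad (real (Suc k)) x) \<longlonglongrightarrow> 0"
      proof (rule Lim_null_comparison)
        show "\<forall>\<^sub>F k in sequentially. norm (test (real (Suc k)) x - x \<bullet> test_grad (real (Suc k)) x)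
            \<le> l1_norm x * (2 * ((1 / l1_norm x + l1_norm x) / real (Suc k)))"
          using test_drift_bound(2)[OF x, of "real (Suc k)" for k]
          by (intro always_eventually allI) (simp only: real_norm_def of_nat_0_less_iff zero_less_Suc)
        show "(\<lambda>k. l1_norm x * (2 * ((1 / l1_norm x + l1_norm x) / real (Suc k)))) \<longlonglongrightarrow> 0"
          by (intro tendsto_mult_right_zero LIMSEQ_Suc[OF lim_const_over_n])
      qed
    qed
  qed simp
  then show ?thesis by simp
qed

text \<open>Fubini turns the pair integral into the iterated one of the weak equation, which is a
  fixed multiple of the vanishing drift.\<close>

lemma integral_bracket_test_tendsto:
  "(\<lambda>k. \<integral>z. K (fst z) (snd z) * bracket (test (real (Suc k))) (fst z) (snd z) \<partial>(F \<Otimes>\<^sub>M F)) \<longlonglongrightarrow> 0"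
proof -
  have "(\<integral>z. K (fst z) (snd z) * bracket (test (real (Suc k))) (fst z) (snd z) \<partial>(F \<Otimes>\<^sub>M F))
      = - (2 / (1 - \<gamma>)) * (\<integral>x. test (real (Suc k)) x - x \<bullet> test_grad (real (Suc k)) x \<partial>F)" for k
  proof -
    have "(\<integral>z. K (fst z) (snd z) * bracket (test (real (Suc k))) (fst z) (snd z) \<partial>(F \<Otimes>\<^sub>M F))
        = (\<integral>x. (\<integral>y. K x y * bracket (test (real (Suc k))) x y \<partial>F) \<partial>F)"
      using integral_fst'[OF integrable_bracket_test[of "real (Suc k)"]] by simp
    then show ?thesis
      using weak_equation[OF test_Cc1[of "real (Suc k)"]] by simp
  qed
  then show ?thesis
    by (simp only:) (intro tendsto_mult_right_zero integral_drift_tendsto)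
qed

text \<open>By symmetry of the kernel, both drop terms in the lower bound for the bracket have the
  same integral.\<close>

lemma integral_drop_swap:
  assumes "1 \<le> n"
  shows "integrable (F \<Otimes>\<^sub>M F) (\<lambda>z. K (fst z) (snd z) * cutoff_drop n (l1_norm (snd z)) (l1_norm (fst z)))"
    and "(\<integral>z. K (fst z) (snd z) * cutoff_drop n (l1_norm (snd z)) (l1_norm (fst z)) \<partial>(F \<Otimes>\<^sub>M F))
      = (\<integral>z. K (fst z) (snd z) * cutoff_drop n (l1_norm (fst z)) (l1_norm (snd z)) \<partial>(F \<Otimes>\<^sub>M F))"
proof -
  have sym: "K (snd z) (fst z) * cutoff_drop n (l1_norm (snd z)) (l1_norm (fst z))
      = K (fst z) (snd z) * cutoff_drop n (l1_norm (snd z)) (l1_norm (fst z))"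
    if "z \<in> space (F \<Otimes>\<^sub>M F)" for z
    using kernel that by (auto simp: coagulation_kernel_def space_pair_measure space_F)
  note int = integrable_drop(1)[OF assms]
  have "integrable (F \<Otimes>\<^sub>M F) (\<lambda>z. K (snd z) (fst z) * cutoff_drop n (l1_norm (snd z)) (l1_norm (fst z)))"
    using integrable_product_swap[OF int] by (simp add: case_prod_beta')
  then show "integrable (F \<Otimes>\<^sub>M F) (\<lambda>z. K (fst z) (snd z) * cutoff_drop n (l1_norm (snd z)) (l1_norm (fst z)))"
    using sym by (simp cong: Bochner_Integration.integrable_cong)
  have "(\<integral>z. K (snd z) (fst z) * cutoff_drop n (l1_norm (snd z)) (l1_norm (fst z)) \<partial>(F \<Otimes>\<^sub>M F))
      = (\<integral>z. K (fst z) (snd z) * cutoff_drop n (l1_norm (fst z)) (l1_norm (snd z)) \<partial>(F \<Otimes>\<^sub>M F))"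
    using integral_product_swap[OF borel_measurable_integrable[OF int]] by (simp add: case_prod_beta')
  then show "(\<integral>z. K (fst z) (snd z) * cutoff_drop n (l1_norm (snd z)) (l1_norm (fst z)) \<partial>(F \<Otimes>\<^sub>M F))
      = (\<integral>z. K (fst z) (snd z) * cutoff_drop n (l1_norm (fst z)) (l1_norm (snd z)) \<partial>(F \<Otimes>\<^sub>M F))"
    using sym by (simp cong: Bochner_Integration.integral_cong)
qed

text \<open>The cutoff index \<open>m\<close> stays fixed while the index \<open>k\<close> of the
  test function tends to infinity. Monotonicity of the cutoff bounds the fixed integral by the
  bracket and drop integrals at \<open>k\<close>, all of which tend to 0.\<close>

lemma integral_defect_eq_0:
  "(\<integral>z. K (fst z) (snd z) * (triangle_defect (fst z) (snd z)
      * cutoff (real (Suc m)) (l1_norm (fst z) + l1_norm (snd z))) \<partial>(F \<Otimes>\<^sub>M F)) = 0"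
  (is "integral\<^sup>L _ (?G m) = 0")
proof (rule antisym)
  let ?B = "\<lambda>k z. K (fst z) (snd z) * bracket (test (real (Suc k))) (fst z) (snd z)"
  let ?Q = "\<lambda>k z. K (fst z) (snd z) * cutoff_drop (real (Suc k)) (l1_norm (fst z)) (l1_norm (snd z))"
  let ?R = "\<lambda>k z. K (fst z) (snd z) * cutoff_drop (real (Suc k)) (l1_norm (snd z)) (l1_norm (fst z))"
  have "integral\<^sup>L (F \<Otimes>\<^sub>M F) (?G m) \<le> integral\<^sup>L (F \<Otimes>\<^sub>M F) (?B k) + 2 * integral\<^sup>L (F \<Otimes>\<^sub>M F) (?Q k)"
    if "m \<le> k" for k
  proof -
    have int: "integrable (F \<Otimes>\<^sub>M F) (?B k)" "integrable (F \<Otimes>\<^sub>M F) (?Q k)" "integrable (F \<Otimes>\<^sub>M F) (?R k)"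
      by (intro integrable_bracket_test integrable_drop(1) integral_drop_swap(1); simp)+
    have "integral\<^sup>L (F \<Otimes>\<^sub>M F) (?G m) \<le> (\<integral>z. ?B k z + ?Q k z + ?R k z \<partial>(F \<Otimes>\<^sub>M F))"
    proof (rule integral_mono)
      show "integrable (F \<Otimes>\<^sub>M F) (?G m)"
        by (intro integrable_defect) simp
      show "integrable (F \<Otimes>\<^sub>M F) (\<lambda>z. ?B k z + ?Q k z + ?R k z)"
        by (intro Bochner_Integration.integrable_add int)
      fix z
      assume "z \<in> space (F \<Otimes>\<^sub>M F)"
      then have z: "fst z \<in> punctured_orthant" "snd z \<in> punctured_orthant"
        by (auto simp: space_pair_measure space_F)
      then have pos: "0 < l1_norm (fst z) + l1_norm (snd z)"
        by (rule l1_norm_add_pos)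
      have "triangle_defect (fst z) (snd z) * cutoff (real (Suc m)) (l1_norm (fst z) + l1_norm (snd z))
          \<le> triangle_defect (fst z) (snd z) * cutoff (real (Suc k)) (l1_norm (fst z) + l1_norm (snd z))"
        using that triangle_defect_range(1) pos by (intro mult_left_mono cutoff_mono) auto
      also have "\<dots> \<le> bracket (test (real (Suc k))) (fst z) (snd z)
          + cutoff_drop (real (Suc k)) (l1_norm (fst z)) (l1_norm (snd z))
          + cutoff_drop (real (Suc k)) (l1_norm (snd z)) (l1_norm (fst z))"
        by (rule bracket_test_lower[OF z])
      finally show "?G m z \<le> ?B k z + ?Q k z + ?R k z"
        using kernel_nonneg[OF z] unfolding distrib_left[symmetric] by (rule mult_left_mono)
    qed
    also have "\<dots> = integral\<^sup>L (F \<Otimes>\<^sub>M F) (?B k) + 2 * integral\<^sup>L (F \<Otimes>\<^sub>M F) (?Q k)"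
      using int integral_drop_swap(2)[of "real (Suc k)"] by simp
    finally show ?thesis .
  qed
  moreover have "(\<lambda>k. integral\<^sup>L (F \<Otimes>\<^sub>M F) (?B k) + 2 * integral\<^sup>L (F \<Otimes>\<^sub>M F) (?Q k)) \<longlonglongrightarrow> 0"
    by (rule tendsto_add_zero[OF integral_bracket_test_tendsto tendsto_mult_right_zero[OF integral_drop_tendsto]])
  ultimately show "integral\<^sup>L (F \<Otimes>\<^sub>M F) (?G m) \<le> 0"
    by (intro LIMSEQ_le_const) auto
  show "0 \<le> integral\<^sup>L (F \<Otimes>\<^sub>M F) (?G m)"
    by (intro Bochner_Integration.integral_nonneg defect_nonneg) auto
qed

text \<open>A nonnegative integrand with integral 0 vanishes almost everywhere. Outside one null set
  this holds for all \<open>m\<close> at once; the kernel is positive, and some cutoff is positive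
  at the given total size, so the defect itself is 0.\<close>

lemma AE_triangle_defect_eq_0: "AE x in F. AE y in F. triangle_defect x y = 0"
proof -
  have "AE z in F \<Otimes>\<^sub>M F. K (fst z) (snd z) * (triangle_defect (fst z) (snd z)
      * cutoff (real (Suc m)) (l1_norm (fst z) + l1_norm (snd z))) = 0" (is "AE z in _. ?G m z = 0") for m
  proof (rule integral_nonneg_eq_0_iff_AE[THEN iffD1, OF _ _ integral_defect_eq_0])
    show "integrable (F \<Otimes>\<^sub>M F) (?G m)"
      by (intro integrable_defect) simp
    show "AE z in F \<Otimes>\<^sub>M F. 0 \<le> ?G m z"
      by (intro AE_I2 defect_nonneg) auto
  qed
  then have "AE z in F \<Otimes>\<^sub>M F. \<forall>m. K (fst z) (snd z) * (triangle_defect (fst z) (snd z)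
      * cutoff (real (Suc m)) (l1_norm (fst z) + l1_norm (snd z))) = 0"
    unfolding AE_all_countable by blast
  moreover have "AE z in F \<Otimes>\<^sub>M F. fst z \<in> punctured_orthant \<and> snd z \<in> punctured_orthant"
    by (intro AE_I2) (auto simp: space_pair_measure space_F)
  ultimately have "AE z in F \<Otimes>\<^sub>M F. triangle_defect (fst z) (snd z) = 0"
  proof eventually_elim
    case (elim z)
    then have "K (fst z) (snd z) \<noteq> 0"
      using kernel_pos[OF kernel, of "fst z" "snd z"] by auto
    moreover obtain k where "0 < cutoff (real (Suc k)) (l1_norm (fst z) + l1_norm (snd z))"
      using cutoff_pos[OF l1_norm_add_pos] elim(2) by blast
    ultimately show ?case
      using elim(1)[rule_format, of k] by simp
  qed
  then show ?thesis
    using AE_pair[of "\<lambda>z. triangle_defect (fst z) (snd z) = 0"] by simp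
qed

text \<open>Unless the measure is zero, some point \<open>x\<close> is parallel to almost every
  \<open>y\<close>; normalising this single \<open>x\<close> gives the direction.\<close>

lemma concentrated_on_ray:
  obtains \<theta> where "\<theta> \<in> unit_simplex" "AE x in F. x = l1_norm x *\<^sub>R \<theta>"
proof (cases "AE x in F. False")
  case True
  obtain \<theta> :: 'a where "\<theta> \<in> unit_simplex"
    using unit_simplex_nonempty by blast
  moreover have "AE x in F. x = l1_norm x *\<^sub>R \<theta>"
    using True by eventually_elim simp
  ultimately show ?thesis by (rule that)
next
  case False
  have "\<exists>x\<in>punctured_orthant. AE y in F. triangle_defect x y = 0"
  proof (rule ccontr)
    assume none: "\<not> ?thesis"
    have "AE x in F. x \<in> punctured_orthant"
      by (intro AE_I2) (simp add: space_F)
    then have "AE x in F. False"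
      using AE_triangle_defect_eq_0 by eventually_elim (use none in blast)
    with False show False ..
  qed
  then obtain x where x: "x \<in> punctured_orthant" and ae: "AE y in F. triangle_defect x y = 0"
    by blast
  let ?\<theta> = "inverse (l1_norm x) *\<^sub>R x"
  have s: "0 < l1_norm x" "0 < norm x"
    using x l1_norm_pos by (auto simp: punctured_orthant_def)
  have "?\<theta> \<in> unit_simplex"
    using s x by (simp add: unit_simplex_def punctured_orthant_scaleR l1_norm_scaleR)
  moreover have "AE y in F. y = l1_norm y *\<^sub>R ?\<theta>"
    using ae
  proof eventually_elim
    case (elim y)
    \<comment> \<open>This is the equality case of the triangle inequality in an inner product
      space.\<close>
    then have "norm x *\<^sub>R y = norm y *\<^sub>R x"
      using norm_triangle_eq[of x y] by (simp add: triangle_defect_def)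
    then have "inverse (norm x) *\<^sub>R (norm x *\<^sub>R y) = inverse (norm x) *\<^sub>R (norm y *\<^sub>R x)"
      by simp
    then have y: "y = (norm y / norm x) *\<^sub>R x"
      using s by (simp add: divide_inverse mult.commute)
    then have "l1_norm y = norm y / norm x * l1_norm x"
      using l1_norm_scaleR[of "norm y / norm x" x] by simp
    then have "norm y / norm x = l1_norm y * inverse (l1_norm x)"
      using s by (simp add: field_simps)
    then show ?case
      using y by simp
  qed
  ultimately show ?thesis by (rule that)
qed

section \<open>The image under the \<open>l1\<close> norm as a one-component profile\<close>

definition radial :: "real measure" where
  "radial = distr F (restrict_space borel punctured_orthant) l1_norm"

lemma l1_norm_measurable_half_line:
  "l1_norm \<in> measurable F (restrict_space borel punctured_orthant)"
  unfolding punctured_orthant_real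
  by (intro measurable_restrict_space2) (auto simp: space_F dest: l1_norm_pos)

lemma emeasure_radial:
  assumes "A \<in> sets (restrict_space borel punctured_orthant)"
  shows "emeasure radial A = emeasure F {x \<in> punctured_orthant. l1_norm x \<in> A}"
  unfolding radial_def emeasure_distr[OF l1_norm_measurable_half_line assms] space_F
  by (intro arg_cong[where f = "emeasure F"]) auto

text \<open>Preimages of compact sets are compact shells, hence of finite measure. For inner
  regularity, a compact \<open>C\<close> inside the preimage of \<open>A\<close> has a compact image
  inside \<open>A\<close>, whose radial mass is at least that of \<open>C\<close>.\<close>

lemma radon_radial: "radon_measure_on punctured_orthant radial"
  unfolding radon_measure_on_def
proof (intro conjI allI impI ballI)
  show sets: "sets radial = sets (restrict_space borel punctured_orthant)"
    by (simp add: radial_def)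
  show "emeasure radial C < \<infinity>" if C: "compact C \<and> C \<subseteq> punctured_orthant" for C
  proof -
    have "compact {x \<in> punctured_orthant. l1_norm x \<in> C}"
      using C by (intro compact_l1_shell) (auto simp: punctured_orthant_real)
    moreover have "{x \<in> punctured_orthant. l1_norm x \<in> C} \<subseteq> punctured_orthant"
      by blast
    ultimately have "emeasure F {x \<in> punctured_orthant. l1_norm x \<in> C} < \<infinity>"
      using radon unfolding radon_measure_on_def by blast
    then show ?thesis
      using C by (simp only: emeasure_radial compact_in_sets_restrict_space)
  qed
  fix A
  assume A: "A \<in> sets radial"
  let ?P = "{x \<in> punctured_orthant. l1_norm x \<in> A} :: 'a set"
  have P: "?P \<in> sets F"
    using measurable_sets[OF l1_norm_measurable_half_line] A
    by (simp add: sets space_F vimage_def Int_def conj_commute)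
  show "emeasure radial A = (SUP C\<in>{C. compact C \<and> C \<subseteq> A}. emeasure radial C)"
  proof (rule antisym)
    show "(SUP C\<in>{C. compact C \<and> C \<subseteq> A}. emeasure radial C) \<le> emeasure radial A"
      using A by (intro SUP_least emeasure_mono) auto
    have "emeasure radial A = emeasure F ?P"
      using A by (simp add: emeasure_radial sets)
    also have "\<dots> = (SUP C\<in>{C. compact C \<and> C \<subseteq> ?P}. emeasure F C)"
      using radon P by (simp add: radon_measure_on_def)
    also have "\<dots> \<le> (SUP C\<in>{C. compact C \<and> C \<subseteq> A}. emeasure radial C)"
    proof (rule SUP_mono)
      fix C
      assume "C \<in> {C. compact C \<and> C \<subseteq> ?P}"
      then have C: "compact C" "C \<subseteq> ?P" by auto
      have D: "compact (l1_norm ` C)"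
        using C(1) by (intro compact_continuous_image continuous_intros)
      moreover have "l1_norm ` C \<subseteq> A"
        using C(2) by auto
      moreover have D_sets: "l1_norm ` C \<in> sets (restrict_space borel punctured_orthant)"
        using D C(2) by (intro compact_in_sets_restrict_space) (auto simp: punctured_orthant_real dest!: l1_norm_pos)
      have "emeasure F C \<le> emeasure radial (l1_norm ` C)"
        unfolding emeasure_radial[OF D_sets]
      proof (rule emeasure_mono)
        show "C \<subseteq> {x \<in> punctured_orthant. l1_norm x \<in> l1_norm ` C}"
          using C(2) by auto
        show "{x \<in> punctured_orthant. l1_norm x \<in> l1_norm ` C} \<in> sets F"
          using measurable_sets[OF l1_norm_measurable_half_line D_sets]
          by (simp add: space_F vimage_def Int_def conj_commute)
      qed
      ultimately show "\<exists>D\<in>{C. compact C \<and> C \<subseteq> A}. emeasure F C \<le> emeasure radial D"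
        by (intro bexI[of _ "l1_norm ` C"]) auto
    qed
    finally show "emeasure radial A \<le> (SUP C\<in>{C. compact C \<and> C \<subseteq> A}. emeasure radial C)" .
  qed
qed

lemma integral_radial:
  fixes f :: "real \<Rightarrow> real"
  assumes "f \<in> borel_measurable (restrict_space borel punctured_orthant)"
  shows "(\<integral>s. f s \<partial>radial) = (\<integral>x. f (l1_norm x) \<partial>F)"
  unfolding radial_def by (rule integral_distr[OF l1_norm_measurable_half_line assms])

lemma nn_integral_radial:
  assumes "f \<in> borel_measurable borel"
  shows "(\<integral>\<^sup>+s. f s \<partial>radial) = (\<integral>\<^sup>+x. f (l1_norm x) \<partial>F)"
  unfolding radial_def
  by (rule nn_integral_distr[OF l1_norm_measurable_half_line])
     (simp add: measurable_restrict_space1 assms)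

text \<open>The change of variables is applied to the inner, then to the outer integral. No
  integrability is assumed, because \<open>integral_distr\<close> also holds with the default value
  0. The outer change needs measurability in \<open>s\<close> of the inner integral, obtained from
  joint measurability on the half line times the orthant.\<close>

lemma double_integral_radial:
  fixes g :: "real \<Rightarrow> real \<Rightarrow> real"
  assumes g: "continuous_on ({0<..} \<times> {0<..}) (\<lambda>z. g (fst z) (snd z))"
  shows "(\<integral>s. (\<integral>r. g s r \<partial>radial) \<partial>radial) = (\<integral>x. (\<integral>y. g (l1_norm x) (l1_norm y) \<partial>F) \<partial>F)"
proof -
  let ?N = "restrict_space borel punctured_orthant :: real measure"
  have inner: "(\<integral>r. g s r \<partial>radial) = (\<integral>y. g s (l1_norm y) \<partial>F)" if "0 < s" for s
  proof -
    have "continuous_on {0<..} (\<lambda>r. (s, r))"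
      by (intro continuous_intros)
    from continuous_on_compose2[OF g this] that
    have "continuous_on {0<..} (\<lambda>r. g s r)"
      by auto
    then show ?thesis
      by (intro integral_radial measurable_half_line)
  qed
  have "(\<lambda>z. (fst z, l1_norm (snd z))) \<in> measurable (?N \<Otimes>\<^sub>M F) (restrict_space borel ({0<..} \<times> {0<..}))"
  proof (rule measurable_restrict_space2)
    show "(\<lambda>z. (fst z, l1_norm (snd z))) \<in> space (?N \<Otimes>\<^sub>M F) \<rightarrow> {0<..} \<times> {0<..}"
      by (auto simp: space_pair_measure space_F space_restrict_space punctured_orthant_real dest: l1_norm_pos)
    have "(\<lambda>s. s) \<in> borel_measurable ?N"
      by (intro measurable_half_line continuous_intros)
    then show "(\<lambda>z. (fst z, l1_norm (snd z))) \<in> borel_measurable (?N \<Otimes>\<^sub>M F)"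
      by (intro borel_measurable_Pair measurable_compose[OF measurable_fst]
          measurable_compose[OF measurable_snd l1_norm_measurable_F])
  qed
  from measurable_compose[OF this borel_measurable_continuous_on_restrict[OF g]]
  have "case_prod (\<lambda>s y. g s (l1_norm y)) \<in> borel_measurable (?N \<Otimes>\<^sub>M F)"
    by (simp add: case_prod_beta')
  then have "(\<lambda>s. \<integral>y. g s (l1_norm y) \<partial>F) \<in> borel_measurable ?N"
    by (rule base.borel_measurable_lebesgue_integral)
  then have "(\<integral>s. (\<integral>y. g s (l1_norm y) \<partial>F) \<partial>radial) = (\<integral>x. (\<integral>y. g (l1_norm x) (l1_norm y) \<partial>F) \<partial>F)"
    by (rule integral_radial)
  moreover have "(\<integral>s. (\<integral>r. g s r \<partial>radial) \<partial>radial) = (\<integral>s. (\<integral>y. g s (l1_norm y) \<partial>F) \<partial>radial)"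
    using inner by (intro Bochner_Integration.integral_cong)
      (auto simp: radial_def space_restrict_space punctured_orthant_real)
  ultimately show ?thesis by simp
qed

text \<open>A direction in the simplex has \<open>l1\<close> norm 1, so
  \<open>s *\<^sub>R \<theta>\<close> has size \<open>s\<close> and the bounds transfer with the
  same constants.\<close>

lemma coagulation_kernel_ray:
  assumes \<theta>: "\<theta> \<in> unit_simplex"
  shows "coagulation_kernel \<gamma> p c\<^sub>1 c\<^sub>2 (\<lambda>s r. K (s *\<^sub>R \<theta>) (r *\<^sub>R \<theta>))"
proof -
  have ray: "s *\<^sub>R \<theta> \<in> punctured_orthant" "l1_norm (s *\<^sub>R \<theta>) = l1_norm s" if "0 < s" for s
    using \<theta> that by (auto simp: unit_simplex_def punctured_orthant_scaleR l1_norm_scaleR l1_norm_real)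
  have "continuous_on ({0<..} \<times> {0<..}) (\<lambda>z. K (fst z *\<^sub>R \<theta>) (snd z *\<^sub>R \<theta>))"
  proof -
    have "continuous_on ({0<..} \<times> {0<..}) (\<lambda>z. (fst z *\<^sub>R \<theta>, snd z *\<^sub>R \<theta>))"
      by (intro continuous_intros)
    from continuous_on_compose2[OF continuous_on_kernel this]
    show ?thesis
      by (simp add: image_subset_iff ray)
  qed
  moreover have "K (s *\<^sub>R \<theta>) (r *\<^sub>R \<theta>) = K (r *\<^sub>R \<theta>) (s *\<^sub>R \<theta>) \<and> 0 \<le> K (s *\<^sub>R \<theta>) (r *\<^sub>R \<theta>) \<and>
      (\<forall>q>0. K ((q *\<^sub>R s) *\<^sub>R \<theta>) ((q *\<^sub>R r) *\<^sub>R \<theta>) = q powr \<gamma> * K (s *\<^sub>R \<theta>) (r *\<^sub>R \<theta>)) \<and>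
      c\<^sub>1 * (l1_norm s + l1_norm r) powr \<gamma> * Phi p (l1_norm s / (l1_norm s + l1_norm r)) \<le> K (s *\<^sub>R \<theta>) (r *\<^sub>R \<theta>) \<and>
      K (s *\<^sub>R \<theta>) (r *\<^sub>R \<theta>) \<le> c\<^sub>2 * (l1_norm s + l1_norm r) powr \<gamma> * Phi p (l1_norm s / (l1_norm s + l1_norm r))"
    if sr: "0 < s" "0 < r" for s r
    using kernel ray(1)[OF sr(1)] ray(1)[OF sr(2)]
    unfolding coagulation_kernel_def ray(2)[OF sr(1), symmetric] ray(2)[OF sr(2), symmetric]
      real_scaleR_def scaleR_scaleR[symmetric]
    by blast
  ultimately show ?thesis
    using kernel by (simp add: coagulation_kernel_def punctured_orthant_real case_prod_beta')
qed

text \<open>Moments depend only on sizes and transfer directly. The equation for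
  \<open>\<phi>\<close> is the one for the lifted function \<open>\<phi> (l1_norm x)\<close>: almost
  every point equals its size times \<open>\<theta>\<close>, which identifies the kernels, and sizes
  add.\<close>

lemma self_similar_profile_radial:
  assumes \<theta>: "\<theta> \<in> unit_simplex" and ray: "AE x in F. x = l1_norm x *\<^sub>R \<theta>"
  shows "self_similar_profile \<gamma> p (\<lambda>s r. K (s *\<^sub>R \<theta>) (r *\<^sub>R \<theta>)) radial"
  unfolding self_similar_profile_def
proof (intro conjI allI impI)
  show "\<exists>c\<^sub>1 c\<^sub>2. coagulation_kernel \<gamma> p c\<^sub>1 c\<^sub>2 (\<lambda>s r. K (s *\<^sub>R \<theta>) (r *\<^sub>R \<theta>))"
    using coagulation_kernel_ray[OF \<theta>] by blast
  show "radon_measure_on punctured_orthant radial"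
    by (rule radon_radial)
  have idem: "l1_norm (l1_norm x) = l1_norm x" for x :: 'a
    by (simp add: l1_norm_real) (simp add: l1_norm_def sum_nonneg)
  have "(\<integral>\<^sup>+s\<in>{s. l1_norm s \<ge> 1}. ennreal (l1_norm s powr (\<gamma> + p)) \<partial>radial)
      = (\<integral>\<^sup>+x\<in>{x. l1_norm x \<ge> 1}. ennreal (l1_norm x powr (\<gamma> + p)) \<partial>F)"
    unfolding l1_norm_real
    by (subst nn_integral_radial) (simp_all add: idem[unfolded l1_norm_real] indicator_def)
  moreover have "(\<integral>\<^sup>+s\<in>{s. l1_norm s < 1}. ennreal (l1_norm s powr (1 - p)) \<partial>radial)
      = (\<integral>\<^sup>+x\<in>{x. l1_norm x < 1}. ennreal (l1_norm x powr (1 - p)) \<partial>F)"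
    unfolding l1_norm_real
    by (subst nn_integral_radial) (simp_all add: idem[unfolded l1_norm_real] indicator_def)
  moreover have "(\<integral>\<^sup>+s. ennreal (l1_norm s) \<partial>radial) = (\<integral>\<^sup>+x. ennreal (l1_norm x) \<partial>F)"
    unfolding l1_norm_real
    by (subst nn_integral_radial) (simp_all add: idem[unfolded l1_norm_real])
  ultimately show "(\<integral>\<^sup>+s\<in>{s. l1_norm s \<ge> 1}. ennreal (l1_norm s powr (\<gamma> + p)) \<partial>radial)
      + (\<integral>\<^sup>+s\<in>{s. l1_norm s < 1}. ennreal (l1_norm s powr (1 - p)) \<partial>radial)
      + (\<integral>\<^sup>+s. ennreal (l1_norm s) \<partial>radial) < \<infinity>"
    using profile unfolding self_similar_profile_def by simp
next
  fix \<phi> D :: "real \<Rightarrow> real"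
  assume \<phi>: "Cc1_on punctured_orthant \<phi> D"
  let ?\<psi> = "\<lambda>x::'a. \<phi> (l1_norm x)"
  let ?g = "\<lambda>s r. K (s *\<^sub>R \<theta>) (r *\<^sub>R \<theta>) * (\<phi> (s + r) - \<phi> s - \<phi> r)"
  have \<psi>: "Cc1_on punctured_orthant ?\<psi> (\<lambda>x. D (l1_norm x) *\<^sub>R One)"
    by (rule Cc1_radial[OF \<phi>])
  have cont_\<phi>: "continuous_on {0<..} \<phi>" and cont_D: "continuous_on {0<..} D"
    using \<phi> Cc1_continuous[OF \<phi>] by (auto simp: Cc1_on_def punctured_orthant_real)
  have cont_g: "continuous_on ({0<..} \<times> {0<..}) (\<lambda>z. ?g (fst z) (snd z))"
  proof -
    have "continuous_on ({0<..} \<times> {0<..}) (\<lambda>z. K (fst z *\<^sub>R \<theta>) (snd z *\<^sub>R \<theta>))"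
      using coagulation_kernel_ray[OF \<theta>]
      by (simp add: coagulation_kernel_def punctured_orthant_real case_prod_beta')
    then show ?thesis
      by (intro continuous_intros continuous_on_compose2[OF cont_\<phi>]) auto
  qed
  have cont_gF: "continuous_on (punctured_orthant \<times> punctured_orthant)
      (\<lambda>z. ?g (l1_norm (fst z :: 'a)) (l1_norm (snd z :: 'a)))"
  proof -
    have "continuous_on (punctured_orthant \<times> punctured_orthant) (\<lambda>z. (l1_norm (fst z :: 'a), l1_norm (snd z :: 'a)))"
      by (intro continuous_intros)
    from continuous_on_compose2[OF cont_g this]
    show ?thesis
      by (simp add: image_subset_iff l1_norm_pos)
  qed
  have cont_b: "continuous_on (punctured_orthant \<times> punctured_orthant) (\<lambda>z. K (fst z) (snd z) * bracket ?\<psi> (fst z) (snd z))"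
    by (intro continuous_intros continuous_on_kernel continuous_on_bracket Cc1_continuous[OF \<psi>])
  have slice: "(\<lambda>y. f (x, y)) \<in> borel_measurable F"
    if "continuous_on (punctured_orthant \<times> punctured_orthant) f" "x \<in> punctured_orthant"
    for f :: "'a \<times> 'a \<Rightarrow> real" and x
    using that measurable_compose_Pair1[OF _ measurable_pair_F[OF that(1)]] by (simp add: space_F)
  have orthant: "AE x in F. x \<in> punctured_orthant"
    by (intro AE_I2) (simp add: space_F)
  have "(\<integral>s. (\<integral>r. ?g s r \<partial>radial) \<partial>radial) = (\<integral>x. (\<integral>y. ?g (l1_norm x) (l1_norm y) \<partial>F) \<partial>F)"
    by (rule double_integral_radial[OF cont_g])
  \<comment> \<open>The ray condition holds only almost everywhere, so it is used once in
    \<open>x\<close> and, for each good \<open>x\<close>, again in \<open>y\<close>.\<close>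
  also have "\<dots> = (\<integral>x. (\<integral>y. K x y * bracket ?\<psi> x y \<partial>F) \<partial>F)"
  proof (rule integral_cong_AE)
    show "(\<lambda>x. \<integral>y. ?g (l1_norm x) (l1_norm y) \<partial>F) \<in> borel_measurable F"
      using measurable_pair_F[OF cont_gF]
      by (intro base.borel_measurable_lebesgue_integral) (simp add: case_prod_beta')
    show "(\<lambda>x. \<integral>y. K x y * bracket ?\<psi> x y \<partial>F) \<in> borel_measurable F"
      using measurable_pair_F[OF cont_b]
      by (intro base.borel_measurable_lebesgue_integral) (simp add: case_prod_beta')
    show "AE x in F. (\<integral>y. ?g (l1_norm x) (l1_norm y) \<partial>F) = (\<integral>y. K x y * bracket ?\<psi> x y \<partial>F)"
      using ray orthant
    proof eventually_elim
      case x: (elim x)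
      show ?case
      proof (rule integral_cong_AE)
        show "(\<lambda>y. ?g (l1_norm x) (l1_norm y)) \<in> borel_measurable F"
          using slice[OF cont_gF x(2)] by simp
        show "(\<lambda>y. K x y * bracket ?\<psi> x y) \<in> borel_measurable F"
          using slice[OF cont_b x(2)] by simp
        show "AE y in F. ?g (l1_norm x) (l1_norm y) = K x y * bracket ?\<psi> x y"
          using ray orthant
        proof eventually_elim
          case y: (elim y)
          show ?case
            using x(1) y(1) l1_norm_add[OF x(2) y(2)] by (simp add: bracket_def)
        qed
      qed
    qed
  qed
  also have "\<dots> = - (2 / (1 - \<gamma>)) * (\<integral>x. ?\<psi> x - x \<bullet> (D (l1_norm x) *\<^sub>R One) \<partial>F)"
    by (rule weak_equation[OF \<psi>])
  also have "(\<integral>x. ?\<psi> x - x \<bullet> (D (l1_norm x) *\<^sub>R One) \<partial>F) = (\<integral>x. \<phi> (l1_norm x) - l1_norm x * D (l1_norm x) \<partial>F)"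
    by (intro Bochner_Integration.integral_cong)
       (auto simp: space_F l1_norm_eq_inner inner_commute simp del: inner_sum_left)
  also have "\<dots> = (\<integral>s. \<phi> s - s * D s \<partial>radial)"
    by (rule integral_radial[symmetric]) (intro measurable_half_line continuous_intros cont_\<phi> cont_D)
  finally show "0 = 1 / 2 * (\<integral>s. (\<integral>r. K (s *\<^sub>R \<theta>) (r *\<^sub>R \<theta>) * (\<phi> (s + r) - \<phi> s - \<phi> r) \<partial>radial) \<partial>radial)
      + 1 / (1 - \<gamma>) * (\<integral>s. \<phi> s - s \<bullet> D s \<partial>radial)"
    by simp
qed

text \<open>Almost every \<open>x\<close> may be replaced by
  \<open>l1_norm x *\<^sub>R \<theta>\<close>, after which the integrand depends on the size alone
  and can be pushed forward.\<close>

lemma integral_on_ray: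
  fixes \<psi> :: "'a \<Rightarrow> real"
  assumes \<theta>: "\<theta> \<in> unit_simplex" and ray: "AE x in F. x = l1_norm x *\<^sub>R \<theta>"
    and \<psi>: "continuous_on punctured_orthant \<psi>"
  shows "(\<integral>x. \<psi> x \<partial>F) = (\<integral>s. \<psi> (s *\<^sub>R \<theta>) \<partial>radial)"
proof -
  have "continuous_on {0<..} (\<lambda>s. \<psi> (s *\<^sub>R \<theta>))"
    using \<theta> by (intro continuous_on_compose2[OF \<psi>] continuous_intros)
      (auto simp: unit_simplex_def punctured_orthant_scaleR)
  then have meas: "(\<lambda>s. \<psi> (s *\<^sub>R \<theta>)) \<in> borel_measurable (restrict_space borel punctured_orthant)"
    by (rule measurable_half_line)
  have "(\<integral>x. \<psi> x \<partial>F) = (\<integral>x. \<psi> (l1_norm x *\<^sub>R \<theta>) \<partial>F)"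
  proof (rule integral_cong_AE)
    show "AE x in F. \<psi> x = \<psi> (l1_norm x *\<^sub>R \<theta>)"
      using ray by eventually_elim simp
    show "(\<lambda>x. \<psi> (l1_norm x *\<^sub>R \<theta>)) \<in> borel_measurable F"
      using measurable_compose[OF l1_norm_measurable_half_line meas] .
  qed (rule measurable_F[OF \<psi>])
  then show ?thesis
    using integral_radial[OF meas] by simp
qed

end

theorem theorem1p5:
  fixes K :: "real ^ 'n \<Rightarrow> real ^ 'n \<Rightarrow> real"
    and F :: "(real ^ 'n) measure"
    and \<gamma> p c\<^sub>1 c\<^sub>2 :: real
  assumes "coagulation_kernel \<gamma> p c\<^sub>1 c\<^sub>2 K"
    and "self_similar_profile \<gamma> p K F"
  shows "\<exists>\<theta>\<^sub>0\<in>unit_simplex. \<exists>F\<^sub>0 :: real measure.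
           self_similar_profile \<gamma> p (\<lambda>s r. K (s *\<^sub>R \<theta>\<^sub>0) (r *\<^sub>R \<theta>\<^sub>0)) F\<^sub>0 \<and>
           (\<forall>\<psi>. Cc_on punctured_orthant \<psi> \<longrightarrow>
              (\<integral>\<xi>. \<psi> \<xi> \<partial>F) = (\<integral>\<rho>. \<psi> (\<rho> *\<^sub>R \<theta>\<^sub>0) \<partial>F\<^sub>0))"
proof -
  interpret profile \<gamma> p c\<^sub>1 c\<^sub>2 K F
    by (rule profile.intro[OF assms])
  obtain \<theta> where \<theta>: "\<theta> \<in> unit_simplex" "AE x in F. x = l1_norm x *\<^sub>R \<theta>"
    by (rule concentrated_on_ray)
  have "\<forall>\<psi>. Cc_on punctured_orthant \<psi> \<longrightarrow> (\<integral>\<xi>. \<psi> \<xi> \<partial>F) = (\<integral>\<rho>. \<psi> (\<rho> *\<^sub>R \<theta>) \<partial>radial)"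
    using integral_on_ray[OF \<theta>] by (simp add: Cc_on_def)
  then show ?thesis
    using self_similar_profile_radial[OF \<theta>] \<theta>(1) by blast
qed

end
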